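(* Let $0<\alpha<1$, $T>0$, and let $\{\lambda_k\}_{k\ge1}$ be defined by $\lambda_1=1$ and $$\lambda_{k+1}=\sum_{j=1}^k\big((k-j+1)^{\alpha-1}-(k-j+2)^{\alpha-1}\big)\lambda_j,\quad k\ge1.$$ It holds that $$\lambda_{k+1}<\lambda_k\le\frac{1}{k^\alpha},\qquad \sum_{j=1}^k\lambda_j\le k^{1-\alpha},\qquad k\ge1,$$ and, as $\tau\to0$, $$\tau^{-\alpha}\sum_{k=1}^\infty\lambda_k\chi_{(t_{k-1},t_k]}(t)\rightharpoonup\frac{t^{-\alpha}}{\Gamma_\alpha\Gamma_{1-\alpha}}\quad\text{weakly in }L^p(0,T),\text{ for } 1\le p<1/\alpha.$$ Moreover, for any family $f^{(\tau)}\to f$ strongly convergent in $L^q(0,T)$ (as $\tau\to0$) for some $q\in[1,\infty)$, we have $$\frac{1}{\tau^\alpha}\int_0^{t_n}\sum_{k=1}^n\lambda_k\chi_{(t_{k-1},t_k]}(s)\,f^{(\tau)}(t-s)\,ds\ \to\ \frac{1}{\Gamma_\alpha\Gamma_{1-\alpha}}\int_0^t s^{-\alpha}f(t-s)\,ds\qquad (n=\lfloor t/\tau\rfloor)$$ strongly in $L^r(0,T)$ (as functions of $t$) for every $1\le r<\frac{q}{1-(1-\alpha)q}$.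
   Context: $\tau>0$, $t_k=k\tau$, $\chi_A$ is the characteristic function of the set $A$, $\Gamma_z$ denotes the Gamma function at $z$. In the convolution statement, for each $t\in(0,T)$, $n=\lfloor t/\tau\rfloor$, so $t_n\le t<t_{n+1}$. *)

theory Defs
  imports "HOL-Analysis.Analysis"
begin

text \<open>
  Elements of \<open>L\<^sup>p\<close> are represented by functions rather than by almost-everywhere classes,
  so \<open>Lp_norm\<close> is only a seminorm.
\<close>

definition Lp_space :: "real \<Rightarrow> 'a measure \<Rightarrow> ('a \<Rightarrow> real) set" where
  "Lp_space p M = {u \<in> borel_measurable M. integrable M (\<lambda>x. \<bar>u x\<bar> powr p)}"

definition Lp_norm :: "real \<Rightarrow> 'a measure \<Rightarrow> ('a \<Rightarrow> real) \<Rightarrow> real" where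
  "Lp_norm p M u = (LINT x|M. \<bar>u x\<bar> powr p) powr (1 / p)"

text \<open>
  Bounded linear functionals on \<open>L\<^sup>p\<close>. The bound forces \<open>\<phi>\<close> to identify functions of
  \<open>Lp_space p M\<close> that agree almost everywhere, so these are exactly the elements of the dual of
  the quotient space; the values of \<open>\<phi>\<close> outside \<open>Lp_space p M\<close> are irrelevant.
\<close>

definition Lp_dual :: "real \<Rightarrow> 'a measure \<Rightarrow> (('a \<Rightarrow> real) \<Rightarrow> real) set" where
  "Lp_dual p M = {\<phi>.
     (\<forall>u\<in>Lp_space p M. \<forall>v\<in>Lp_space p M. \<phi> (\<lambda>x. u x + v x) = \<phi> u + \<phi> v) \<and>
     (\<forall>c. \<forall>u\<in>Lp_space p M. \<phi> (\<lambda>x. c * u x) = c * \<phi> u) \<and>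
     (\<exists>C. \<forall>u\<in>Lp_space p M. \<bar>\<phi> u\<bar> \<le> C * Lp_norm p M u)}"

text \<open>
  Convergence, as \<open>\<tau>\<close> tends to \<open>0\<close> from the right, of a family indexed by the step sizes \<open>\<tau> > 0\<close>.
\<close>

definition Lp_strong_limit ::
    "real \<Rightarrow> 'a measure \<Rightarrow> (real \<Rightarrow> 'a \<Rightarrow> real) \<Rightarrow> ('a \<Rightarrow> real) \<Rightarrow> bool" where
  "Lp_strong_limit p M u v \<longleftrightarrow>
     (\<forall>\<tau>>0. u \<tau> \<in> Lp_space p M) \<and> v \<in> Lp_space p M \<and>
     ((\<lambda>\<tau>. Lp_norm p M (\<lambda>x. u \<tau> x - v x)) \<longlongrightarrow> 0) (at_right 0)"

definition Lp_weak_limit ::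
    "real \<Rightarrow> 'a measure \<Rightarrow> (real \<Rightarrow> 'a \<Rightarrow> real) \<Rightarrow> ('a \<Rightarrow> real) \<Rightarrow> bool" where
  "Lp_weak_limit p M u v \<longleftrightarrow>
     (\<forall>\<tau>>0. u \<tau> \<in> Lp_space p M) \<and> v \<in> Lp_space p M \<and>
     (\<forall>\<phi>\<in>Lp_dual p M. ((\<lambda>\<tau>. \<phi> (u \<tau>)) \<longlongrightarrow> \<phi> v) (at_right 0))"

definition mesh_cell :: "real \<Rightarrow> nat \<Rightarrow> real set" where
  "mesh_cell \<tau> k = {(real k - 1) * \<tau><..real k * \<tau>}"

end

theory Submission
  imports Defs
begin

text \<open>
  With \<open>b m = (m + 1) powr (\<alpha> - 1)\<close> the recursion says exactly that
  \<open>(\<Sum>j=1..k. b (k - j) * lam j) = 1\<close> for every \<open>k \<ge> 1\<close> (lemma \<open>renewal\<close>). This is a discrete form of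
  Abel's integral equation \<open>\<integral> (t - s) powr (\<alpha> - 1) * \<lambda> s ds = 1\<close>, whose solution is
  \<open>t powr (- \<alpha>) / (Gamma \<alpha> * Gamma (1 - \<alpha>))\<close>, and everything is read off from it.

  Monotonicity is a theorem of Kaluza: because \<open>b\<close> is strictly log-convex, the reciprocal of the
  power series with coefficients \<open>b\<close> has negative coefficients after the first one, and those
  coefficients are the differences \<open>lam (k + 1) - lam k\<close>. Replacing all \<open>b (k - j)\<close> in the identity
  by the smallest one, \<open>b (k - 1)\<close>, bounds the partial sums; replacing also all \<open>lam j\<close> by \<open>lam k\<close>
  bounds \<open>lam k\<close>.

  The heart of the matter is the exact asymptotics of the weights (lemma \<open>lam_asymptotics\<close>).
  Abel's inversion has a discrete counterpart: convolving the identity with \<open>i powr (- \<alpha>)\<close> replaces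
  \<open>b\<close> by a sequence that converges to the Beta integral \<open>Gamma \<alpha> * Gamma (1 - \<alpha>)\<close>
  (lemma \<open>discrete_Beta_tendsto\<close>), which determines the growth of the partial sums of \<open>lam\<close>. Since
  \<open>lam\<close> is decreasing, the growth of the partial sums can be differentiated
  (lemma \<open>monotone_density\<close>). Hence the rescaled step functions converge pointwise; as they lie
  below \<open>t powr (- \<alpha>)\<close>, they converge even strongly in \<open>L\<^sup>p\<close> for \<open>p < 1 / \<alpha>\<close>, and
  weak convergence follows.

  For the convolutions, strong convergence of the kernels in \<open>L\<^sup>p\<close> and of the data in
  \<open>L\<^sup>q\<close> is combined by Young's inequality with \<open>1 / p + 1 / q = 1 + 1 / r\<close>. The condition on \<open>r\<close>
  says precisely that such a \<open>p\<close> can be found below \<open>1 / \<alpha>\<close>, at least when \<open>r \<ge> q\<close>; smaller \<open>r\<close>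
  are covered because the interval is bounded. Since the discrete convolution stops at the last
  mesh point before \<open>t\<close>, the error has a third part besides the errors of the kernel and of the
  data; it only sees the data on \<open>{0<..<\<tau>}\<close>, where their norm tends to \<open>0\<close>
  (lemma \<open>truncated_convolution_error\<close>).
\<close>

section \<open>Monotonicity and bounds of the weights\<close>

text \<open>
  Up to the factor \<open>b 0\<close>, the power series of \<open>d\<close> is the reciprocal of that of \<open>b\<close>. Eliminating between the equations for \<open>n\<close> and
  \<open>n - 1\<close> writes \<open>d n\<close> as a combination of the earlier \<open>d m\<close> with coefficients that contain the
  differences \<open>\<rho> (n - 1) - \<rho> (n - 1 - m)\<close> of the ratios \<open>\<rho> i = b (i + 1) / b i\<close>. Log-convexity makes
  these positive, and the coefficient of the only positive term \<open>d 0\<close> vanishes.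
\<close>

lemma Kaluza_negative:
  fixes b d :: "nat \<Rightarrow> real"
  assumes pos: "\<And>n. 0 < b n"
    and log_convex: "\<And>n. b (Suc n) ^ 2 < b n * b (Suc (Suc n))"
    and d0: "d 0 = 1"
    and conv: "\<And>n. 1 \<le> n \<Longrightarrow> (\<Sum>m\<le>n. d m * b (n - m)) = 0"
    and "1 \<le> n"
  shows "d n < 0"
  using \<open>1 \<le> n\<close>
proof (induction n rule: less_induct)
  case (less n)
  define \<rho> where "\<rho> = (\<lambda>n. b (Suc n) / b n)"
  have "\<rho> n < \<rho> (Suc n)" for n
    using log_convex[of n] pos by (simp add: \<rho>_def field_simps power2_eq_square)
  then have \<rho>_mono: "i < j \<Longrightarrow> \<rho> i < \<rho> j" for i j
    using lift_Suc_mono_less[of \<rho>] by blast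
  have shift: "b (Suc i) = b i * \<rho> i" for i
    using pos[of i] by (simp add: \<rho>_def)
  from less.prems obtain l where n: "n = Suc l"
    by (cases n) auto
  show ?case
  proof (cases "l = 0")
    case True
    have "b 1 + d 1 * b 0 = 0"
      using conv[of 1] d0 by simp
    then have "d 1 * b 0 < 0"
      using pos[of 1] by linarith
    then show ?thesis
      using pos[of 0] True n by (simp add: mult_less_0_iff)
  next
    case False
    have "d n * b 0 = - (\<Sum>m\<le>l. d m * b (Suc l - m))"
      using conv[of "Suc l"] n by simp
    also have "\<dots> = - (\<Sum>m\<le>l. d m * b (l - m) * \<rho> (l - m))"
      by (intro arg_cong[where f = uminus] sum.cong) (auto simp: Suc_diff_le shift mult.assoc)
    also have "\<dots> = \<rho> l * (\<Sum>m\<le>l. d m * b (l - m)) - (\<Sum>m\<le>l. d m * b (l - m) * \<rho> (l - m))"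
      using conv[of l] False by simp
    also have "\<dots> = (\<Sum>m\<le>l. d m * b (l - m) * (\<rho> l - \<rho> (l - m)))"
      by (simp add: sum_distrib_left sum_subtractf algebra_simps)
    also have "\<dots> < (\<Sum>m\<le>l. 0)"
    proof (rule sum_strict_mono_ex1)
      have neg: "d m * b (l - m) * (\<rho> l - \<rho> (l - m)) < 0" if "m \<le> l" "1 \<le> m" for m
      proof -
        have "d m < 0"
          using less.IH[of m] that n by simp
        then show ?thesis
          using pos[of "l - m"] \<rho>_mono[of "l - m" l] that
          by (simp add: mult_neg_pos)
      qed
      show "\<forall>m\<in>{..l}. d m * b (l - m) * (\<rho> l - \<rho> (l - m)) \<le> 0"
      proof
        fix m assume "m \<in> {..l}"
        then show "d m * b (l - m) * (\<rho> l - \<rho> (l - m)) \<le> 0"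
          using neg[of m] by (cases "m = 0") auto
      qed
      show "\<exists>m\<in>{..l}. d m * b (l - m) * (\<rho> l - \<rho> (l - m)) < 0"
        using neg[of 1] False by (intro bexI[of _ 1]) auto
    qed simp
    finally show ?thesis
      using pos[of 0] by (simp add: mult_less_0_iff)
  qed
qed

locale fractional_weights =
  fixes \<alpha> :: real and lam :: "nat \<Rightarrow> real"
  assumes \<alpha>_pos: "0 < \<alpha>" and \<alpha>_less: "\<alpha> < 1"
    and lam_1: "lam 1 = 1"
    and lam_rec: "\<And>k. k \<ge> 1 \<Longrightarrow>
           lam (k + 1) = (\<Sum>j=1..k. (real (k - j + 1) powr (\<alpha> - 1)
                                     - real (k - j + 2) powr (\<alpha> - 1)) * lam j)"
begin

text \<open>
  The recursion makes the left-hand side independent of \<open>k\<close>: its right-hand side is the difference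
  between the sum for \<open>k\<close> and the part of the sum for \<open>k + 1\<close> without the last term.
\<close>

lemma renewal:
  assumes "1 \<le> k"
  shows "(\<Sum>j=1..k. real (k - j + 1) powr (\<alpha> - 1) * lam j) = 1"
  using assms
proof (induction k rule: dec_induct)
  case base
  then show ?case by (simp add: lam_1[simplified])
next
  case (step k)
  have "(\<Sum>j=1..Suc k. real (Suc k - j + 1) powr (\<alpha> - 1) * lam j)
      = (\<Sum>j=1..k. real (Suc k - j + 1) powr (\<alpha> - 1) * lam j) + lam (Suc k)"
    by simp
  also have "(\<Sum>j=1..k. real (Suc k - j + 1) powr (\<alpha> - 1) * lam j)
      = (\<Sum>j=1..k. real (k - j + 2) powr (\<alpha> - 1) * lam j)"
    by (intro sum.cong) (auto simp: Suc_diff_le)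
  also have "\<dots> + lam (Suc k) = (\<Sum>j=1..k. real (k - j + 1) powr (\<alpha> - 1) * lam j)"
    using lam_rec[of k] step.hyps by (simp add: sum_subtractf left_diff_distrib)
  finally show ?case using step.IH by simp
qed

lemma lam_strict_decreasing:
  assumes "1 \<le> k"
  shows "lam (k + 1) < lam k"
proof -
  define b where "b n = real (n + 1) powr (\<alpha> - 1)" for n
  \<comment> \<open>The renewal identity says that \<open>lam\<close> (shifted by one) convolved with \<open>b\<close> is the constant
     sequence \<open>1\<close>; taking differences, \<open>d\<close> convolved with \<open>b\<close> is the unit sequence.\<close>
  define d where "d n = (if n = 0 then 1 else lam (n + 1) - lam n)" for n
  have "d k < 0"
  proof (rule Kaluza_negative[of b])
    show "0 < b n" for n by (simp add: b_def)
    show "b (Suc n) ^ 2 < b n * b (Suc (Suc n))" for n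
    proof -
      have "b n * b (Suc (Suc n)) = ((real n + 1) * (real n + 3)) powr (\<alpha> - 1)"
        by (simp add: b_def powr_mult add_ac)
      moreover have "b (Suc n) ^ 2 = ((real n + 2) * (real n + 2)) powr (\<alpha> - 1)"
        by (simp add: b_def powr_mult add_ac power2_eq_square)
      moreover have "(real n + 1) * (real n + 3) < (real n + 2) * (real n + 2)"
        by (simp add: algebra_simps)
      ultimately show ?thesis
        using \<alpha>_less by (auto intro!: powr_less_mono2_neg)
    qed
    show "d 0 = 1" by (simp add: d_def)
    show "(\<Sum>m\<le>n. d m * b (n - m)) = 0" if n: "1 \<le> n" for n
    proof -
      have "(\<Sum>m\<le>n. d m * b (n - m)) = b n + (\<Sum>m=1..n. d m * b (n - m))"
        by (simp add: atMost_atLeast0 sum.atLeast_Suc_atMost d_def)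
      also have "(\<Sum>m=1..n. d m * b (n - m))
          = (\<Sum>m=1..n. lam (Suc m) * b (n - m)) - (\<Sum>m=1..n. lam m * b (n - m))"
        by (subst sum_subtractf[symmetric], intro sum.cong) (auto simp: d_def algebra_simps)
      also have "(\<Sum>m=1..n. lam m * b (n - m)) = 1"
        using renewal[OF n] by (simp add: b_def mult.commute add.commute)
      also have "(\<Sum>m=1..n. lam (Suc m) * b (n - m)) = (\<Sum>m=Suc 1..Suc n. lam m * b (Suc n - m))"
        by (subst sum.shift_bounds_cl_Suc_ivl) simp
      also have "b n + (\<dots> - 1) = (\<Sum>m=1..Suc n. lam m * b (Suc n - m)) - 1"
        by (subst sum.atLeast_Suc_atMost[of 1 "Suc n"]) (auto simp: lam_1[simplified])
      also have "\<dots> = 0"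
        using renewal[of "Suc n"] n by (simp add: b_def mult.commute add.commute)
      finally show ?thesis .
    qed
  qed (use assms in auto)
  then show ?thesis using assms by (simp add: d_def)
qed

lemma lam_antimono:
  assumes "1 \<le> i" "i \<le> j"
  shows "lam j \<le> lam i"
  using assms(2)
proof (induction rule: dec_induct)
  case (step n)
  then show ?case using lam_strict_decreasing[of n] assms(1) by simp
qed simp

lemma lam_pos:
  assumes "1 \<le> k"
  shows "0 < lam k"
  using assms
proof (induction k rule: less_induct)
  case (less n)
  show ?case
  proof (cases "n = 1")
    case True
    then show ?thesis by (simp add: lam_1[simplified])
  next
    case False
    with less.prems obtain m where m: "n = m + 1" "1 \<le> m"
      by (cases n) auto
    have "0 < (\<Sum>j=1..m. (real (m - j + 1) powr (\<alpha> - 1)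
                                 - real (m - j + 2) powr (\<alpha> - 1)) * lam j)"
    proof (intro sum_pos)
      fix j assume j: "j \<in> {1..m}"
      then have "0 < lam j" using less.IH[of j] m by simp
      moreover have "real (m - j + 2) powr (\<alpha> - 1) < real (m - j + 1) powr (\<alpha> - 1)"
        using \<alpha>_less by (intro powr_less_mono2_neg) auto
      ultimately show "0 < (real (m - j + 1) powr (\<alpha> - 1)
                                 - real (m - j + 2) powr (\<alpha> - 1)) * lam j"
        by simp
    qed (use m in auto)
    then show ?thesis using lam_rec[of m] m by simp
  qed
qed

lemma sum_lam_le:
  assumes "1 \<le> k"
  shows "(\<Sum>j=1..k. lam j) \<le> real k powr (1 - \<alpha>)"
proof -
  have "real k powr (\<alpha> - 1) * (\<Sum>j=1..k. lam j) \<le> (\<Sum>j=1..k. real (k - j + 1) powr (\<alpha> - 1) * lam j)"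
    unfolding sum_distrib_left
  proof (rule sum_mono)
    fix j assume j: "j \<in> {1..k}"
    have "real k powr (\<alpha> - 1) \<le> real (k - j + 1) powr (\<alpha> - 1)"
      using j \<alpha>_less by (intro powr_mono2') auto
    then show "real k powr (\<alpha> - 1) * lam j \<le> real (k - j + 1) powr (\<alpha> - 1) * lam j"
      using lam_pos[of j] j by (intro mult_right_mono) auto
  qed
  also have "\<dots> = 1" by (rule renewal[OF assms])
  finally show ?thesis
    using assms by (simp add: powr_diff field_simps)
qed

lemma lam_le:
  assumes "1 \<le> k"
  shows "lam k \<le> real k powr (- \<alpha>)"
proof -
  have "lam k * real k powr \<alpha> = (\<Sum>j=1..k. real k powr (\<alpha> - 1) * lam k)"
    using assms by (simp add: powr_diff)
  also have "\<dots> \<le> (\<Sum>j=1..k. real (k - j + 1) powr (\<alpha> - 1) * lam j)"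
  proof (rule sum_mono)
    fix j assume j: "j \<in> {1..k}"
    have "real k powr (\<alpha> - 1) \<le> real (k - j + 1) powr (\<alpha> - 1)"
      using j \<alpha>_less by (intro powr_mono2') auto
    then show "real k powr (\<alpha> - 1) * lam k \<le> real (k - j + 1) powr (\<alpha> - 1) * lam j"
      using lam_antimono[of j k] lam_pos[of k] j assms by (intro mult_mono) auto
  qed
  also have "\<dots> = 1" by (rule renewal[OF assms])
  finally show ?thesis
    using assms by (simp add: powr_minus field_simps)
qed

end

section \<open>Asymptotics of the weights\<close>

lemma mem_mesh_cell_iff:
  assumes "0 < \<tau>" "0 < t"
  shows "t \<in> mesh_cell \<tau> k \<longleftrightarrow> k = nat \<lceil>t / \<tau>\<rceil>"
proof -
  have pos: "0 < \<lceil>t / \<tau>\<rceil>" using assms by simp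
  have "t \<in> mesh_cell \<tau> k \<longleftrightarrow> real k - 1 < t / \<tau> \<and> t / \<tau> \<le> real k"
    using assms by (auto simp: mesh_cell_def field_simps)
  also have "\<dots> \<longleftrightarrow> \<lceil>t / \<tau>\<rceil> = int k"
    by (auto simp: ceiling_eq_iff)
  also have "\<dots> \<longleftrightarrow> k = nat \<lceil>t / \<tau>\<rceil>"
    using pos by auto
  finally show ?thesis .
qed

lemma has_bochner_integral_mesh_cell:
  assumes "0 < \<tau>"
  shows "has_bochner_integral lborel (indicator (mesh_cell \<tau> k)) \<tau>"
proof -
  have "has_bochner_integral lborel (indicator (mesh_cell \<tau> k)) (measure lborel (mesh_cell \<tau> k))"
    using assms
    by (intro has_bochner_integral_real_indicator) (auto simp: mesh_cell_def algebra_simps)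
  also have "measure lborel (mesh_cell \<tau> k) = \<tau>"
    using assms by (simp add: mesh_cell_def algebra_simps)
  finally show ?thesis .
qed

text \<open>
  Riemann sums of functions with integrable singularities: the value \<open>c n i\<close> is placed on the
  cell number \<open>i\<close> of a mesh of width \<open>1 / n\<close>, so that the sum is the integral of a step function and
  dominated convergence applies. The cell containing \<open>x\<close> has number \<open>\<lceil>x * n\<rceil>\<close>.
\<close>

lemma dominated_Riemann_sums:
  fixes F G :: "real \<Rightarrow> real" and c :: "nat \<Rightarrow> nat \<Rightarrow> real"
  assumes F: "set_integrable lborel {0<..<1} F"
    and G: "G \<in> borel_measurable borel"
    and bound: "\<And>n x. 1 \<le> n \<Longrightarrow> 0 < x \<Longrightarrow> x < 1 \<Longrightarrow> \<bar>c n (nat \<lceil>x * real n\<rceil>)\<bar> \<le> F x"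
    and lim: "\<And>x. 0 < x \<Longrightarrow> x < 1 \<Longrightarrow> (\<lambda>n. c n (nat \<lceil>x * real n\<rceil>)) \<longlonglongrightarrow> G x"
  shows "(\<lambda>n. (\<Sum>i=1..n. c n i) / real n) \<longlonglongrightarrow> (LINT x:{0<..<1}|lborel. G x)"
proof -
  define s where "s n x = (if n = 0 then 0 else indicator {0<..<1} x * c n (nat \<lceil>x * real n\<rceil>))"
    for n and x :: real
  have s_measurable [measurable]: "s n \<in> borel_measurable borel" for n
    unfolding s_def by measurable
  have "(\<lambda>n. LINT x|lborel. s n x) \<longlonglongrightarrow> (LINT x|lborel. indicator {0<..<1} x * G x)"
  proof (rule integral_dominated_convergence)
    show "integrable lborel (\<lambda>x. indicator {0<..<1} x * F x)"
      using F by (simp add: set_integrable_def)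
    show "(\<lambda>x. indicator {0<..<1} x * G x) \<in> borel_measurable lborel"
      using G by measurable
    show "s n \<in> borel_measurable lborel" for n
      by (simp add: s_measurable)
    show "AE x in lborel. (\<lambda>n. s n x) \<longlonglongrightarrow> indicator {0<..<1} x * G x"
    proof (intro AE_I2)
      fix x :: real
      have "(\<lambda>n. indicator {0<..<1} x * c n (nat \<lceil>x * real n\<rceil>)) \<longlonglongrightarrow> indicator {0<..<1} x * G x"
        by (auto simp: indicator_def intro: lim)
      then show "(\<lambda>n. s n x) \<longlonglongrightarrow> indicator {0<..<1} x * G x"
        by (rule Lim_transform_eventually)
          (auto simp: s_def eventually_sequentially intro!: exI[of _ 1])
    qed
    show "AE x in lborel. norm (s n x) \<le> indicator {0<..<1} x * F x" for n
    proof (intro AE_I2)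
      fix x :: real
      have "0 \<le> F x" if "0 < x" "x < 1"
        using bound[of 1 x] that by linarith
      then show "norm (s n x) \<le> indicator {0<..<1} x * F x"
        by (auto simp: s_def indicator_def intro: bound)
    qed
  qed
  moreover have "(LINT x|lborel. s n x) = (\<Sum>i=1..n. c n i) / real n" if n: "1 \<le> n" for n
  proof -
    have "has_bochner_integral lborel (\<lambda>x. \<Sum>i=1..n. c n i * indicator (mesh_cell (1 / real n) i) x)
            (\<Sum>i=1..n. c n i * (1 / real n))"
      using n by (intro has_bochner_integral_sum has_bochner_integral_mult_right
          has_bochner_integral_mesh_cell) auto
    moreover have "(\<Sum>i=1..n. c n i * indicator (mesh_cell (1 / real n) i) x) = s n x"
      if x: "x \<noteq> 1" for x
    proof (cases "0 < x \<and> x < 1")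
      case True
      have "nat \<lceil>x * real n\<rceil> \<in> {1..n}"
    proof -
      have "0 < \<lceil>x * real n\<rceil>" "\<lceil>x * real n\<rceil> \<le> int n"
        using True n by (auto simp: ceiling_le_iff)
      then show ?thesis by (simp only: atLeastAtMost_iff) linarith
    qed
      then have "(\<Sum>i=1..n. c n i * indicator (mesh_cell (1 / real n) i) x)
          = (\<Sum>i=1..n. if i = nat \<lceil>x * real n\<rceil> then c n i else 0)"
        using True n by (intro sum.cong) (auto simp: mem_mesh_cell_iff indicator_def)
      then show ?thesis
        using \<open>_ \<in> {1..n}\<close> True n by (simp add: s_def)
    next
      case False
      have "x \<notin> mesh_cell (1 / real n) i" if i: "i \<in> {1..n}" for i
      proof
        assume "x \<in> mesh_cell (1 / real n) i"
        then have *: "(real i - 1) / real n < x" "x \<le> real i / real n"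
          by (auto simp: mesh_cell_def)
        moreover have "0 \<le> (real i - 1) / real n" "real i / real n \<le> 1"
          using i by auto
        ultimately have "0 < x" "x \<le> 1" by linarith+
        then show False using False x by auto
      qed
      then show ?thesis using False by (simp add: s_def)
    qed
    ultimately have "has_bochner_integral lborel (s n) (\<Sum>i=1..n. c n i * (1 / real n))"
      by (subst has_bochner_integral_cong_AE[symmetric])
        (auto intro: AE_mp[OF AE_lborel_singleton[of 1]])
    then show ?thesis
      by (simp add: has_bochner_integral_integral_eq sum_divide_distrib)
  qed
  ultimately show ?thesis
    by (subst tendsto_cong[of _ "\<lambda>n. LINT x|lborel. s n x"])
      (auto simp: set_lebesgue_integral_def eventually_sequentially intro!: exI[of _ 1])
qed

lemma set_integrable_Beta:
  fixes a b :: real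
  assumes "0 < a" "0 < b"
  shows "set_integrable lborel {0<..<1} (\<lambda>x. x powr (a - 1) * (1 - x) powr (b - 1))"
    and "(LINT x:{0<..<1}|lborel. x powr (a - 1) * (1 - x) powr (b - 1)) = Beta a b"
proof -
  have I: "((\<lambda>x. x powr (a - 1) * (1 - x) powr (b - 1)) has_integral Beta a b) {0<..<1}"
    using has_integral_Beta_real[OF assms] by (simp add: has_integral_Icc_iff_Ioo)
  then have "set_integrable lebesgue {0<..<1} (\<lambda>x. x powr (a - 1) * (1 - x) powr (b - 1))"
    by (intro nonnegative_absolutely_integrable_1) (auto simp: has_integral_integrable)
  then show S: "set_integrable lborel {0<..<1} (\<lambda>x. x powr (a - 1) * (1 - x) powr (b - 1))"
    unfolding set_integrable_def by (subst (asm) integrable_completion) auto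
  show "(LINT x:{0<..<1}|lborel. x powr (a - 1) * (1 - x) powr (b - 1)) = Beta a b"
    using set_borel_integral_eq_integral(2)[OF S] I by (simp add: integral_unique)
qed

lemma set_integrable_powr_from_0:
  fixes a c :: real
  assumes "-1 < a" "0 \<le> c"
  shows "set_integrable lborel {0<..<c} (\<lambda>x. x powr a)"
proof -
  have "(\<lambda>x. x powr a) absolutely_integrable_on {0<..c}"
    using assms by (intro nonnegative_absolutely_integrable_1 integrable_on_powr_from_0') auto
  then have "set_integrable lebesgue {0<..<c} (\<lambda>x. x powr a)"
    by (rule set_integrable_subset) auto
  then show ?thesis
    unfolding set_integrable_def by (subst (asm) integrable_completion) auto
qed

lemma ceiling_ratio_tendsto:
  assumes "0 < (x::real)"
  shows "(\<lambda>n. real (nat \<lceil>x * real n\<rceil>) / real n) \<longlonglongrightarrow> x"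
proof (rule tendsto_sandwich)
  show "\<forall>\<^sub>F n in sequentially. x \<le> real (nat \<lceil>x * real n\<rceil>) / real n"
    using eventually_gt_at_top[of 0] by eventually_elim (simp add: field_simps real_nat_ceiling_ge)
  show "\<forall>\<^sub>F n in sequentially. real (nat \<lceil>x * real n\<rceil>) / real n \<le> x + 1 / real n"
    using eventually_gt_at_top[of 0]
  proof eventually_elim
    case (elim n)
    have "real (nat \<lceil>x * real n\<rceil>) \<le> x * real n + 1"
      using assms elim by (simp add: ceiling_correct of_nat_nat)
    then show ?case using elim by (simp add: field_simps)
  qed
  show "(\<lambda>n. x + 1 / real n) \<longlonglongrightarrow> x"
    using tendsto_add[OF tendsto_const lim_1_over_n, of x] by simp
qed simp

lemma powr_sum_asymptotics:
  fixes \<alpha> :: real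
  assumes "0 < \<alpha>" "\<alpha> < 1"
  shows "(\<lambda>n. (\<Sum>i=1..n. real i powr (- \<alpha>)) / real n powr (1 - \<alpha>)) \<longlonglongrightarrow> 1 / (1 - \<alpha>)"
proof -
  have ss: "set_integrable lborel {0<..<1} (\<lambda>x. x powr (- \<alpha>))"
    using assms by (intro set_integrable_powr_from_0) auto
  have ii: "(LINT x:{0<..<1}|lborel. x powr (- \<alpha>)) = 1 / (1 - \<alpha>)"
  proof -
    have eq: "indicator {0<..<1} x * (x powr (1 - \<alpha> - 1) * (1 - x) powr (1 - 1))
        = indicator {0<..<1} x * x powr (- \<alpha>)" for x :: real
      by (auto simp: indicator_def)
    have "Gamma (1 - \<alpha> + 1) = (1 - \<alpha>) * Gamma (1 - \<alpha>)"
      using assms by (intro Gamma_plus1) (auto dest: nonpos_Ints_nonpos)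
    moreover have "Gamma (1 - \<alpha>) > 0" using assms by (intro Gamma_real_pos) auto
    ultimately have "Beta (1 - \<alpha>) 1 = 1 / (1 - \<alpha>)"
      by (simp add: Beta_def)
    then show ?thesis
      using set_integrable_Beta(2)[of "1 - \<alpha>" 1] assms
      unfolding set_lebesgue_integral_def real_scaleR_def eq by simp
  qed
  have "(\<lambda>n. (\<Sum>i=1..n. (real i / real n) powr (- \<alpha>)) / real n) \<longlonglongrightarrow> 1 / (1 - \<alpha>)"
    unfolding ii[symmetric]
  proof (rule dominated_Riemann_sums[OF ss])
    fix x :: real assume x: "0 < x" "x < 1"
    show "(\<lambda>n. (real (nat \<lceil>x * real n\<rceil>) / real n) powr (- \<alpha>)) \<longlonglongrightarrow> x powr (- \<alpha>)"
      using x by (intro tendsto_powr ceiling_ratio_tendsto) auto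
    fix n :: nat assume n: "1 \<le> n"
    have "x \<le> real (nat \<lceil>x * real n\<rceil>) / real n"
      using n by (simp add: field_simps real_nat_ceiling_ge)
    then show "\<bar>(real (nat \<lceil>x * real n\<rceil>) / real n) powr (- \<alpha>)\<bar> \<le> x powr (- \<alpha>)"
      using x assms by (simp add: powr_mono2')
  qed simp
  moreover have "(\<Sum>i=1..n. (real i / real n) powr (- \<alpha>)) / real n
      = (\<Sum>i=1..n. real i powr (- \<alpha>)) / real n powr (1 - \<alpha>)" if "1 \<le> n" for n
  proof -
    have "real n powr (1 - \<alpha>) = real n powr (- \<alpha>) * real n"
      using that by (simp add: powr_diff powr_minus field_simps)
    then show ?thesis
      by (simp add: powr_divide sum_divide_distrib[symmetric])
  qed
  ultimately show ?thesis
    by (subst tendsto_cong) (auto simp: eventually_sequentially intro!: exI[of _ 1])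
qed

text \<open>
  The discrete convolution of the two powers is a Riemann sum for the Beta integral. The shift by one
  in \<open>m - i + 1\<close> keeps the sum below the integrand at both endpoints: on the cell
  \<open>((i - 1) / m, i / m]\<close> both \<open>i / m \<ge> x\<close> and \<open>(m - i + 1) / m \<ge> 1 - x\<close> hold.
\<close>

lemma discrete_Beta_tendsto:
  fixes \<alpha> :: real
  assumes "0 < \<alpha>" "\<alpha> < 1"
  shows "(\<lambda>m. \<Sum>i=1..m. real i powr (\<alpha> - 1) * real (m - i + 1) powr (- \<alpha>))
           \<longlonglongrightarrow> Gamma \<alpha> * Gamma (1 - \<alpha>)"
proof -
  have B: "Beta \<alpha> (1 - \<alpha>) = Gamma \<alpha> * Gamma (1 - \<alpha>)"
    by (simp add: Beta_def)
  have ss: "set_integrable lborel {0<..<1} (\<lambda>x. x powr (\<alpha> - 1) * (1 - x) powr (- \<alpha>))"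
   and ii: "(LINT x:{0<..<1}|lborel. x powr (\<alpha> - 1) * (1 - x) powr (- \<alpha>)) = Gamma \<alpha> * Gamma (1 - \<alpha>)"
    using set_integrable_Beta[of \<alpha> "1 - \<alpha>"] assms B by simp_all
  have "(\<lambda>m. (\<Sum>i=1..m. (real i / real m) powr (\<alpha> - 1) * (real (m - i + 1) / real m) powr (- \<alpha>)) / real m)
           \<longlonglongrightarrow> Gamma \<alpha> * Gamma (1 - \<alpha>)"
    unfolding ii[symmetric]
  proof (rule dominated_Riemann_sums[OF ss])
    fix x :: real assume x: "0 < x" "x < 1"
    have eq: "real (n - nat \<lceil>x * real n\<rceil> + 1) / real n = 1 - real (nat \<lceil>x * real n\<rceil>) / real n + 1 / real n"
      if "1 \<le> n" for n
    proof -
      have "nat \<lceil>x * real n\<rceil> \<le> n"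
        using x that by (simp add: nat_le_iff ceiling_le_iff)
      then show ?thesis using that by (simp add: of_nat_diff field_simps)
    qed
    have "(\<lambda>n. 1 - real (nat \<lceil>x * real n\<rceil>) / real n + 1 / real n) \<longlonglongrightarrow> 1 - x + 0"
      using x by (intro tendsto_intros ceiling_ratio_tendsto lim_1_over_n)
    then have "(\<lambda>n. 1 - real (nat \<lceil>x * real n\<rceil>) / real n + 1 / real n) \<longlonglongrightarrow> 1 - x"
      by simp
    then have lim: "(\<lambda>n. real (n - nat \<lceil>x * real n\<rceil> + 1) / real n) \<longlonglongrightarrow> 1 - x"
    proof (rule Lim_transform_eventually)
      show "\<forall>\<^sub>F n in sequentially. 1 - real (nat \<lceil>x * real n\<rceil>) / real n + 1 / real n
          = real (n - nat \<lceil>x * real n\<rceil> + 1) / real n"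
        using eventually_ge_at_top[of 1] by eventually_elim (rule eq[symmetric])
    qed
    show "(\<lambda>n. (real (nat \<lceil>x * real n\<rceil>) / real n) powr (\<alpha> - 1)
            * (real (n - nat \<lceil>x * real n\<rceil> + 1) / real n) powr (- \<alpha>))
            \<longlonglongrightarrow> x powr (\<alpha> - 1) * (1 - x) powr (- \<alpha>)"
      using x by (intro tendsto_intros tendsto_powr ceiling_ratio_tendsto lim) auto
    fix n :: nat assume n: "1 \<le> n"
    have "x \<le> real (nat \<lceil>x * real n\<rceil>) / real n"
      using n by (simp add: field_simps real_nat_ceiling_ge)
    then have 1: "(real (nat \<lceil>x * real n\<rceil>) / real n) powr (\<alpha> - 1) \<le> x powr (\<alpha> - 1)"
      using x assms by (simp add: powr_mono2')
    have "real (nat \<lceil>x * real n\<rceil>) \<le> x * real n + 1"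
      using x n by (simp add: of_nat_nat)
    then have "1 - x \<le> real (n - nat \<lceil>x * real n\<rceil> + 1) / real n"
      unfolding eq[OF n] using n by (simp add: field_simps)
    then have 2: "(real (n - nat \<lceil>x * real n\<rceil> + 1) / real n) powr (- \<alpha>) \<le> (1 - x) powr (- \<alpha>)"
      using x assms by (simp add: powr_mono2')
    show "\<bar>(real (nat \<lceil>x * real n\<rceil>) / real n) powr (\<alpha> - 1)
            * (real (n - nat \<lceil>x * real n\<rceil> + 1) / real n) powr (- \<alpha>)\<bar>
            \<le> x powr (\<alpha> - 1) * (1 - x) powr (- \<alpha>)"
      using mult_mono[OF 1 2] by (simp add: abs_mult)
  qed simp
  moreover have "(\<Sum>i=1..m. (real i / real m) powr (\<alpha> - 1) * (real (m - i + 1) / real m) powr (- \<alpha>)) / real m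
      = (\<Sum>i=1..m. real i powr (\<alpha> - 1) * real (m - i + 1) powr (- \<alpha>))" if "1 \<le> m" for m
  proof -
    have "real m powr (\<alpha> - 1) * real m powr (- \<alpha>) * real m powr 1
        = real m powr (\<alpha> - 1 + - \<alpha> + 1)"
      by (simp only: powr_add)
    then have "real m powr (\<alpha> - 1) * real m powr (- \<alpha>) * real m = 1"
      using that by simp
    then have "a / real m powr (\<alpha> - 1) * (b / real m powr (- \<alpha>)) / real m = a * b" for a b
      by (simp add: mult.assoc)
    then show ?thesis
      by (simp only: sum_divide_distrib powr_divide)
  qed
  ultimately show ?thesis
    by (subst (asm) tendsto_cong) (auto simp: eventually_sequentially intro!: exI[of _ 1])
qed


text \<open>
  After rescaling this is again a Riemann sum: the summands are bounded by a multiple of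
  \<open>x powr (- \<alpha>)\<close>, and on the cell of \<open>x\<close> the argument \<open>n - j + 1\<close> grows like \<open>(1 - x) * n\<close>, so
  that they tend to \<open>0\<close>.
\<close>

lemma (in fractional_weights) weighted_sum_lam_tendsto_0:
  assumes e: "e \<longlonglongrightarrow> 0"
  shows "(\<lambda>n. (\<Sum>j=1..n. lam j * e (n - j + 1)) / real n powr (1 - \<alpha>)) \<longlonglongrightarrow> 0"
proof -
  obtain C where C: "\<And>n. \<bar>e n\<bar> \<le> C"
    using convergent_imp_Bseq[OF convergentI[OF e]] by (auto simp: Bseq_def)
  have "0 \<le> C" using C[of 0] by linarith
  have dom: "set_integrable lborel {0<..<1} (\<lambda>x. C * x powr (- \<alpha>))"
    using \<alpha>_less by (intro set_integrable_mult_right set_integrable_powr_from_0) auto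
  have "(\<lambda>n. (\<Sum>j=1..n. real n powr \<alpha> * (lam j * e (n - j + 1))) / real n)
      \<longlonglongrightarrow> (LINT x:{0<..<1::real}|lborel. (0::real))"
  proof (rule dominated_Riemann_sums[OF dom])
    have bound: "\<bar>real n powr \<alpha> * (lam (nat \<lceil>x * real n\<rceil>) * e m)\<bar> \<le> x powr (- \<alpha>) * \<bar>e m\<bar>"
      if n: "1 \<le> n" and x: "0 < x" "x < 1" for n m and x :: real
    proof -
      define k where "k = nat \<lceil>x * real n\<rceil>"
      have "0 < x * real n" using n x by simp
      moreover have k: "x * real n \<le> real k" by (simp add: k_def real_nat_ceiling_ge)
      ultimately have k1: "1 \<le> k" by (cases k) auto
      have "lam k \<le> real k powr (- \<alpha>)" by (rule lam_le[OF k1])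
      also have "\<dots> \<le> (x * real n) powr (- \<alpha>)"
        using \<open>0 < x * real n\<close> k \<alpha>_pos by (intro powr_mono2') auto
      also have "real n powr \<alpha> * \<dots> = x powr (- \<alpha>)"
        using n x by (simp add: powr_mult powr_minus)
      finally have "real n powr \<alpha> * lam k \<le> x powr (- \<alpha>)"
        by (simp add: mult_left_mono)
      then show ?thesis
        using lam_pos[OF k1] by (simp add: k_def[symmetric] abs_mult mult.assoc[symmetric] mult_right_mono)
    qed
    fix x :: real assume x: "0 < x" "x < 1"
    show "\<bar>real n powr \<alpha> * (lam (nat \<lceil>x * real n\<rceil>) * e (n - nat \<lceil>x * real n\<rceil> + 1))\<bar> \<le> C * x powr (- \<alpha>)"
      if "1 \<le> n" for n
    proof -
      have "x powr (- \<alpha>) * \<bar>e (n - nat \<lceil>x * real n\<rceil> + 1)\<bar> \<le> x powr (- \<alpha>) * C"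
        by (intro mult_left_mono C) simp
      then show ?thesis
        using bound[OF that x, of "n - nat \<lceil>x * real n\<rceil> + 1"] by (simp only: mult.commute[of C])
    qed
    show "(\<lambda>n. real n powr \<alpha> * (lam (nat \<lceil>x * real n\<rceil>) * e (n - nat \<lceil>x * real n\<rceil> + 1))) \<longlonglongrightarrow> 0"
    proof (rule Lim_null_comparison)
      show "\<forall>\<^sub>F n in sequentially. norm (real n powr \<alpha> * (lam (nat \<lceil>x * real n\<rceil>) * e (n - nat \<lceil>x * real n\<rceil> + 1)))
          \<le> x powr (- \<alpha>) * \<bar>e (n - nat \<lceil>x * real n\<rceil> + 1)\<bar>"
        using eventually_ge_at_top[of 1] by eventually_elim (use bound x in auto)
      have "filterlim (\<lambda>n. n - nat \<lceil>x * real n\<rceil> + 1) at_top sequentially"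
        unfolding filterlim_at_top
      proof
        fix Z :: nat
        show "\<forall>\<^sub>F n in sequentially. Z \<le> n - nat \<lceil>x * real n\<rceil> + 1"
          using eventually_ge_at_top[of "nat \<lceil>real Z / (1 - x)\<rceil>"]
        proof eventually_elim
          case (elim n)
          then have "real Z / (1 - x) \<le> real n" by linarith
          then have "real Z \<le> real n - x * real n" using x by (simp add: field_simps)
          moreover have "0 \<le> x * real n" using x by simp
          ultimately show ?case by linarith
        qed
      qed
      then have "(\<lambda>n. e (n - nat \<lceil>x * real n\<rceil> + 1)) \<longlonglongrightarrow> 0"
        by (rule filterlim_compose[OF e])
      then show "(\<lambda>n. x powr (- \<alpha>) * \<bar>e (n - nat \<lceil>x * real n\<rceil> + 1)\<bar>) \<longlonglongrightarrow> 0"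
        by (intro tendsto_mult_right_zero tendsto_rabs_zero)
    qed
  qed simp
  moreover have "\<forall>\<^sub>F n in sequentially. (\<Sum>j=1..n. real n powr \<alpha> * (lam j * e (n - j + 1))) / real n
      = (\<Sum>j=1..n. lam j * e (n - j + 1)) / real n powr (1 - \<alpha>)"
    using eventually_ge_at_top[of 1]
    by eventually_elim (simp add: sum_distrib_left[symmetric] powr_diff)
  ultimately show ?thesis
    by (simp add: Lim_transform_eventually set_lebesgue_integral_def)
qed

text \<open>
  The convolution of the renewal identity with \<open>i powr (- \<alpha>)\<close> expresses \<open>\<Sum>i\<le>n. i powr (- \<alpha>)\<close> as
  \<open>\<Sum>j\<le>n. lam j * w (n - j + 1)\<close>, where \<open>w\<close> tends to \<open>Gamma \<alpha> * Gamma (1 - \<alpha>)\<close>. Replacing \<open>w\<close> by its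
  limit costs an error of lower order.
\<close>

lemma (in fractional_weights) sum_lam_asymptotics:
  "(\<lambda>n. (\<Sum>j=1..n. lam j) / real n powr (1 - \<alpha>))
     \<longlonglongrightarrow> 1 / ((1 - \<alpha>) * (Gamma \<alpha> * Gamma (1 - \<alpha>)))"
proof -
  define B where "B = Gamma \<alpha> * Gamma (1 - \<alpha>)"
  define w where "w m = (\<Sum>i=1..m. real i powr (\<alpha> - 1) * real (m - i + 1) powr (- \<alpha>))" for m
  define e where "e m = w m - B" for m
  have "0 < B"
    using \<alpha>_pos \<alpha>_less by (auto simp: B_def intro!: mult_pos_pos Gamma_real_pos)
  have identity: "(\<Sum>i=1..n. real i powr (- \<alpha>)) = (\<Sum>j=1..n. lam j * w (n - j + 1))" for n
  proof -
    have "(\<Sum>i=1..n. real i powr (- \<alpha>)) = (\<Sum>k=1..n. real (n - k + 1) powr (- \<alpha>))"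
      by (rule sum.reindex_bij_witness[of _ "\<lambda>k. n - k + 1" "\<lambda>k. n - k + 1"]) auto
    also have "\<dots> = (\<Sum>k=1..n. \<Sum>j=1..k. real (n - k + 1) powr (- \<alpha>) * (real (k - j + 1) powr (\<alpha> - 1) * lam j))"
    proof (intro sum.cong refl)
      fix k assume "k \<in> {1..n}"
      then show "real (n - k + 1) powr (- \<alpha>)
          = (\<Sum>j=1..k. real (n - k + 1) powr (- \<alpha>) * (real (k - j + 1) powr (\<alpha> - 1) * lam j))"
        using renewal[of k] by (simp only: sum_distrib_left[symmetric]) simp
    qed
    also have "\<dots> = (\<Sum>j=1..n. \<Sum>k=j..n. real (n - k + 1) powr (- \<alpha>) * (real (k - j + 1) powr (\<alpha> - 1) * lam j))"
      unfolding sum.Sigma[OF finite_atLeastAtMost ballI[OF finite_atLeastAtMost]]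
      by (rule sum.reindex_bij_witness[of _ "\<lambda>(j, k). (k, j)" "\<lambda>(k, j). (j, k)"]) auto
    also have "\<dots> = (\<Sum>j=1..n. lam j * w (n - j + 1))"
    proof (intro sum.cong refl)
      fix j assume j: "j \<in> {1..n}"
      have "(\<Sum>k=j..n. real (n - k + 1) powr (- \<alpha>) * (real (k - j + 1) powr (\<alpha> - 1) * lam j))
          = (\<Sum>i=1..n - j + 1. lam j * (real i powr (\<alpha> - 1) * real (n - j + 1 - i + 1) powr (- \<alpha>)))"
        using j by (intro sum.reindex_bij_witness[of _ "\<lambda>i. i + j - 1" "\<lambda>k. k - j + 1"])
          (auto simp: mult_ac)
      then show "(\<Sum>k=j..n. real (n - k + 1) powr (- \<alpha>) * (real (k - j + 1) powr (\<alpha> - 1) * lam j))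
          = lam j * w (n - j + 1)"
        by (simp only: w_def sum_distrib_left)
    qed
    finally show ?thesis .
  qed
  have "e \<longlonglongrightarrow> 0"
    using discrete_Beta_tendsto[OF \<alpha>_pos \<alpha>_less]
    unfolding e_def w_def B_def by (simp add: LIM_zero)
  then have "(\<lambda>n. ((\<Sum>i=1..n. real i powr (- \<alpha>)) / real n powr (1 - \<alpha>)
      - (\<Sum>j=1..n. lam j * e (n - j + 1)) / real n powr (1 - \<alpha>)) / B) \<longlonglongrightarrow> (1 / (1 - \<alpha>) - 0) / B"
    using \<open>0 < B\<close>
    by (intro tendsto_intros powr_sum_asymptotics weighted_sum_lam_tendsto_0 \<alpha>_pos \<alpha>_less) auto
  moreover have "((\<Sum>i=1..n. real i powr (- \<alpha>)) / real n powr (1 - \<alpha>)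
      - (\<Sum>j=1..n. lam j * e (n - j + 1)) / real n powr (1 - \<alpha>)) / B
      = (\<Sum>j=1..n. lam j) / real n powr (1 - \<alpha>)" for n
  proof -
    have "(\<Sum>i=1..n. real i powr (- \<alpha>)) - (\<Sum>j=1..n. lam j * e (n - j + 1)) = B * (\<Sum>j=1..n. lam j)"
      unfolding identity e_def sum_subtractf[symmetric] sum_distrib_left
      by (intro sum.cong) (auto simp: algebra_simps)
    then show ?thesis
      using \<open>0 < B\<close> by (simp add: diff_divide_distrib[symmetric])
  qed
  ultimately show ?thesis by (simp add: B_def)
qed

text \<open>
  For a decreasing sequence the mean of \<open>u\<close> over a block between \<open>n\<close> and \<open>\<theta> * n\<close> lies below \<open>u n\<close>
  if \<open>\<theta> > 1\<close> and above it if \<open>\<theta> < 1\<close>. After scaling, these means tend to \<open>C\<close> times the difference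
  quotient of \<open>\<theta> powr \<beta>\<close> at \<open>1\<close>; letting \<open>\<theta>\<close> tend to \<open>1\<close> from both sides encloses \<open>u n\<close>.
\<close>

lemma monotone_density:
  fixes u :: "nat \<Rightarrow> real" and \<beta> C :: real
  assumes \<beta>: "0 < \<beta>"
    and dec: "\<And>i j. 1 \<le> i \<Longrightarrow> i \<le> j \<Longrightarrow> u j \<le> u i"
    and lim: "(\<lambda>n. (\<Sum>j=1..n. u j) / real n powr \<beta>) \<longlonglongrightarrow> C"
  shows "(\<lambda>n. u n * real n powr (1 - \<beta>)) \<longlonglongrightarrow> \<beta> * C"
proof -
  define S where "S n = (\<Sum>j=1..n. u j)" for n
  define m where "m \<theta> n = nat \<lceil>\<theta> * real n\<rceil>" for \<theta> n
  define Q where "Q \<theta> n = (S (m \<theta> n) - S n) / (real (m \<theta> n) - real n) * real n powr (1 - \<beta>)" for \<theta> n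
  define q where "q \<theta> = C * ((\<theta> powr \<beta> - 1) / (\<theta> - 1))" for \<theta>
  have Q_lim: "Q \<theta> \<longlonglongrightarrow> q \<theta>" if \<theta>: "0 < \<theta>" "\<theta> \<noteq> 1" for \<theta>
  proof -
    have m: "(\<lambda>n. real (m \<theta> n) / real n) \<longlonglongrightarrow> \<theta>"
      unfolding m_def by (rule ceiling_ratio_tendsto[OF \<theta>(1)])
    have m_ge: "\<theta> * real n \<le> real (m \<theta> n)" for n
      by (simp add: m_def real_nat_ceiling_ge)
    have "filterlim (m \<theta>) at_top sequentially"
      unfolding filterlim_at_top
    proof
      fix Z :: nat
      show "\<forall>\<^sub>F n in sequentially. Z \<le> m \<theta> n"
        using eventually_ge_at_top[of "nat \<lceil>real Z / \<theta>\<rceil>"]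
      proof eventually_elim
        case (elim n)
        then have "real Z / \<theta> \<le> real n" by linarith
        then have "real Z \<le> \<theta> * real n" using \<theta> by (simp add: field_simps)
        then show ?case using m_ge[of n] by linarith
      qed
    qed
    then have "(\<lambda>n. S (m \<theta> n) / real (m \<theta> n) powr \<beta>) \<longlonglongrightarrow> C"
      using lim unfolding S_def by (rule filterlim_compose[rotated])
    then have "(\<lambda>n. (S (m \<theta> n) / real (m \<theta> n) powr \<beta> * (real (m \<theta> n) / real n) powr \<beta> - S n / real n powr \<beta>)
        / (real (m \<theta> n) / real n - 1)) \<longlonglongrightarrow> (C * \<theta> powr \<beta> - C) / (\<theta> - 1)"
      using \<theta> lim unfolding S_def[symmetric] by (intro tendsto_intros m) auto
    moreover have "\<forall>\<^sub>F n in sequentially. (S (m \<theta> n) / real (m \<theta> n) powr \<beta> * (real (m \<theta> n) / real n) powr \<beta> - S n / real n powr \<beta>)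
        / (real (m \<theta> n) / real n - 1) = Q \<theta> n"
      using eventually_gt_at_top[of 0]
    proof eventually_elim
      case (elim n)
      have "0 < \<theta> * real n" using \<theta> elim by simp
      then have "0 < real (m \<theta> n)" using m_ge[of n] by linarith
      then have "S (m \<theta> n) / real (m \<theta> n) powr \<beta> * (real (m \<theta> n) / real n) powr \<beta> - S n / real n powr \<beta>
          = (S (m \<theta> n) - S n) / real n powr \<beta>"
        by (simp add: powr_divide diff_divide_distrib)
      moreover have "real (m \<theta> n) / real n - 1 = (real (m \<theta> n) - real n) / real n"
        using elim by (simp add: field_simps)
      ultimately show ?case
        using elim by (simp add: Q_def powr_diff)
    qed
    ultimately have "Q \<theta> \<longlonglongrightarrow> (C * \<theta> powr \<beta> - C) / (\<theta> - 1)"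
      by (rule Lim_transform_eventually)
    then show ?thesis by (simp add: q_def algebra_simps)
  qed
  have "((\<lambda>\<theta>. \<theta> powr \<beta>) has_real_derivative \<beta> * 1 powr (\<beta> - 1)) (at 1)"
    by (rule has_real_derivative_powr) simp
  then have "((\<lambda>\<theta>. (\<theta> powr \<beta> - 1) / (\<theta> - 1)) \<longlongrightarrow> \<beta>) (at 1)"
    by (simp add: has_field_derivative_iff)
  then have "(q \<longlongrightarrow> C * \<beta>) (at 1)"
    unfolding q_def by (intro tendsto_intros)
  then have q_right: "(q \<longlongrightarrow> \<beta> * C) (at_right 1)" and q_left: "(q \<longlongrightarrow> \<beta> * C) (at_left 1)"
    by (auto simp: filterlim_at_split mult.commute)
  have block: "S k = S n + (\<Sum>j\<in>{n<..k}. u j)" if "n \<le> k" for n k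
    unfolding S_def using that
    by (subst sum.union_disjoint[symmetric]) (auto intro!: sum.cong)
  show ?thesis
  proof (rule order_tendstoI)
    fix a assume "a < \<beta> * C"
    then have "\<forall>\<^sub>F \<theta> in at_right 1. a < q \<theta> \<and> 1 < \<theta>"
      by (intro eventually_conj order_tendstoD(1)[OF q_right] eventually_at_right_less)
    then obtain \<theta> where \<theta>: "a < q \<theta>" "1 < \<theta>"
      using eventually_happens trivial_limit_at_right_real by blast
    then have "\<forall>\<^sub>F n in sequentially. a < Q \<theta> n"
      using order_tendstoD(1)[OF Q_lim] by simp
    then show "\<forall>\<^sub>F n in sequentially. a < u n * real n powr (1 - \<beta>)"
      using eventually_gt_at_top[of 0]
    proof eventually_elim
      case (elim n)
      have "real n < \<theta> * real n" using \<theta> elim by simp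
      also have "\<dots> \<le> real (m \<theta> n)" by (simp add: m_def real_nat_ceiling_ge)
      finally have n: "n < m \<theta> n" by simp
      have "(\<Sum>j\<in>{n<..m \<theta> n}. u j) \<le> (\<Sum>j\<in>{n<..m \<theta> n}. u n)"
        using elim by (intro sum_mono dec) auto
      then have "(S (m \<theta> n) - S n) / (real (m \<theta> n) - real n) \<le> u n"
        using n block[of n "m \<theta> n"] by (simp add: field_simps)
      then have "Q \<theta> n \<le> u n * real n powr (1 - \<beta>)"
        unfolding Q_def by (intro mult_right_mono) auto
      then show ?case using elim by simp
    qed
  next
    fix a assume "\<beta> * C < a"
    then have "\<forall>\<^sub>F \<theta> in at_left 1. q \<theta> < a \<and> \<theta> < 1 \<and> 0 < \<theta>"
      using order_tendstoD(2)[OF q_left] eventually_at_left_real[of 0 "1::real"]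
      by (auto elim!: eventually_elim2)
    then obtain \<theta> where \<theta>: "q \<theta> < a" "\<theta> < 1" "0 < \<theta>"
      using eventually_happens trivial_limit_at_left_real by blast
    then have "\<forall>\<^sub>F n in sequentially. Q \<theta> n < a"
      using order_tendstoD(2)[OF Q_lim] by simp
    moreover have "\<forall>\<^sub>F n in sequentially. m \<theta> n < n"
      using eventually_gt_at_top[of "nat \<lceil>1 / (1 - \<theta>)\<rceil>"]
    proof eventually_elim
      case (elim n)
      then have "1 / (1 - \<theta>) < real n" by linarith
      then have "\<theta> * real n + 1 < real n" using \<theta> by (simp add: field_simps)
      moreover have "0 \<le> \<theta> * real n" using \<theta> by simp
      ultimately show ?case unfolding m_def by linarith
    qed
    ultimately show "\<forall>\<^sub>F n in sequentially. u n * real n powr (1 - \<beta>) < a"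
    proof eventually_elim
      case (elim n)
      have "(\<Sum>j\<in>{m \<theta> n<..n}. u n) \<le> (\<Sum>j\<in>{m \<theta> n<..n}. u j)"
        by (intro sum_mono dec) auto
      then have "u n \<le> (S n - S (m \<theta> n)) / (real n - real (m \<theta> n))"
        using elim block[of "m \<theta> n" n] by (simp add: field_simps)
      also have "\<dots> = (S (m \<theta> n) - S n) / (real (m \<theta> n) - real n)"
        by (metis minus_diff_eq minus_divide_divide)
      finally have "u n * real n powr (1 - \<beta>) \<le> Q \<theta> n"
        unfolding Q_def by (intro mult_right_mono) auto
      then show ?case using elim by simp
    qed
  qed
qed

lemma (in fractional_weights) lam_asymptotics:
  "(\<lambda>n. lam n * real n powr \<alpha>) \<longlonglongrightarrow> 1 / (Gamma \<alpha> * Gamma (1 - \<alpha>))"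
  using monotone_density[OF _ lam_antimono sum_lam_asymptotics] \<alpha>_less by simp

section \<open>Young's convolution inequality\<close>

text \<open>
  Concavity of the logarithm in the form of its tangent at the weighted arithmetic mean \<open>A\<close>.
\<close>

lemma weighted_arith_geo_mean3:
  fixes u v w x y z :: real
  assumes "0 \<le> u" "0 \<le> v" "0 \<le> w" and xyz: "0 \<le> x" "0 \<le> y" "0 \<le> z" "x + y + z = 1"
  shows "u powr x * v powr y * w powr z \<le> x * u + y * v + z * w"
proof (cases "u = 0 \<or> v = 0 \<or> w = 0")
  case True
  then have "u powr x * v powr y * w powr z = 0" by auto
  also have "0 \<le> x * u + y * v + z * w"
    using assms by (intro add_nonneg_nonneg mult_nonneg_nonneg)
  finally show ?thesis .
next
  case False
  then have pos: "0 < u" "0 < v" "0 < w" using assms by auto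
  define A where "A = x * u + y * v + z * w"
  have "0 < A"
  proof -
    have "0 < x \<or> 0 < y \<or> 0 < z" using xyz by linarith
    then have "0 < x * u \<or> 0 < y * v \<or> 0 < z * w" using xyz pos by auto
    moreover have "0 \<le> x * u" "0 \<le> y * v" "0 \<le> z * w" using assms by auto
    ultimately show ?thesis unfolding A_def by linarith
  qed
  have ln_le: "ln a \<le> ln A + a / A - 1" if "0 < a" for a
    using ln_le_minus_one[of "a / A"] that \<open>0 < A\<close> by (simp add: ln_div)
  have "ln (u powr x * v powr y * w powr z) = x * ln u + y * ln v + z * ln w"
    using pos by (simp add: ln_mult)
  also have "\<dots> \<le> x * (ln A + u / A - 1) + y * (ln A + v / A - 1) + z * (ln A + w / A - 1)"
    using pos xyz by (intro add_mono mult_left_mono ln_le)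
  also have "\<dots> = (x + y + z) * (ln A - 1) + (x * u + y * v + z * w) / A"
    by (simp add: add_divide_distrib algebra_simps)
  also have "\<dots> = ln A" using xyz \<open>0 < A\<close> by (simp add: A_def[symmetric])
  finally have "u powr x * v powr y * w powr z \<le> A"
    using pos \<open>0 < A\<close> by (subst (asm) ln_le_cancel_iff) auto
  then show ?thesis by (simp add: A_def)
qed

text \<open>
  After division of the three functions by their integrals, Hoelder's inequality is the integrated form
  of the weighted inequality of the means. Weights may vanish, since \<open>0 powr 0 = 0\<close>: if one of the
  three functions is zero almost everywhere, both sides are zero.
\<close>

lemma Holder_inequality3:
  fixes U V W :: "'a \<Rightarrow> real"
  assumes int: "integrable M U" "integrable M V" "integrable M W"
    and nonneg: "\<And>s. 0 \<le> U s" "\<And>s. 0 \<le> V s" "\<And>s. 0 \<le> W s"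
    and xyz: "0 \<le> x" "0 \<le> y" "0 \<le> z" "x + y + z = 1"
  shows "integrable M (\<lambda>s. U s powr x * V s powr y * W s powr z)"
    and "(LINT s|M. U s powr x * V s powr y * W s powr z)
           \<le> (LINT s|M. U s) powr x * (LINT s|M. V s) powr y * (LINT s|M. W s) powr z"
proof -
  note [measurable] = int[THEN borel_measurable_integrable]
  show I: "integrable M (\<lambda>s. U s powr x * V s powr y * W s powr z)"
  proof (rule Bochner_Integration.integrable_bound)
    show "integrable M (\<lambda>s. x * U s + y * V s + z * W s)"
      using int by auto
    show "AE s in M. norm (U s powr x * V s powr y * W s powr z) \<le> norm (x * U s + y * V s + z * W s)"
    proof (intro AE_I2)
      fix s
      have "U s powr x * V s powr y * W s powr z \<le> x * U s + y * V s + z * W s"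
        by (intro weighted_arith_geo_mean3 nonneg xyz)
      then show "norm (U s powr x * V s powr y * W s powr z) \<le> norm (x * U s + y * V s + z * W s)"
        by simp
    qed
  qed measurable
  define a b c where "a = (LINT s|M. U s)" and "b = (LINT s|M. V s)" and "c = (LINT s|M. W s)"
  have ge: "0 \<le> a" "0 \<le> b" "0 \<le> c"
    unfolding a_def b_def c_def using nonneg by (auto intro!: integral_nonneg_AE)
  have "(LINT s|M. U s powr x * V s powr y * W s powr z) \<le> a powr x * b powr y * c powr z"
  proof (cases "a = 0 \<or> b = 0 \<or> c = 0")
    case True
    then have "(AE s in M. U s = 0) \<or> (AE s in M. V s = 0) \<or> (AE s in M. W s = 0)"
      unfolding a_def b_def c_def using int nonneg by (simp add: integral_nonneg_eq_0_iff_AE)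
    then have "AE s in M. U s powr x * V s powr y * W s powr z = 0"
      by auto
    then have "(LINT s|M. U s powr x * V s powr y * W s powr z) = (LINT s|M. 0)"
      by (intro integral_cong_AE) auto
    then show ?thesis by simp
  next
    case False
    then have pos: "0 < a" "0 < b" "0 < c" using ge by auto
    have "(LINT s|M. U s powr x * V s powr y * W s powr z)
        \<le> (LINT s|M. a powr x * b powr y * c powr z * (x * (U s / a) + y * (V s / b) + z * (W s / c)))"
    proof (intro integral_mono I)
      show "integrable M (\<lambda>s. a powr x * b powr y * c powr z * (x * (U s / a) + y * (V s / b) + z * (W s / c)))"
        using int by auto
      fix s
      have "(U s / a) powr x * (V s / b) powr y * (W s / c) powr z \<le> x * (U s / a) + y * (V s / b) + z * (W s / c)"
        using pos nonneg xyz by (intro weighted_arith_geo_mean3) auto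
      then have "a powr x * b powr y * c powr z * ((U s / a) powr x * (V s / b) powr y * (W s / c) powr z)
          \<le> a powr x * b powr y * c powr z * (x * (U s / a) + y * (V s / b) + z * (W s / c))"
        by (intro mult_left_mono) auto
      then show "U s powr x * V s powr y * W s powr z
          \<le> a powr x * b powr y * c powr z * (x * (U s / a) + y * (V s / b) + z * (W s / c))"
        using pos by (simp add: powr_divide)
    qed
    also have "\<dots> = a powr x * b powr y * c powr z * (x * (a / a) + y * (b / b) + z * (c / c))"
      using int by (simp add: a_def b_def c_def)
    also have "\<dots> = a powr x * b powr y * c powr z"
      using pos xyz by simp
    finally show ?thesis .
  qed
  then show "(LINT s|M. U s powr x * V s powr y * W s powr z)
           \<le> (LINT s|M. U s) powr x * (LINT s|M. V s) powr y * (LINT s|M. W s) powr z"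
    by (simp add: a_def b_def c_def)
qed

definition convolution :: "(real \<Rightarrow> real) \<Rightarrow> (real \<Rightarrow> real) \<Rightarrow> real \<Rightarrow> real" where
  "convolution K g t = (LINT s|lborel. K s * g (t - s))"

lemma borel_measurable_convolution [measurable]:
  assumes [measurable]: "K \<in> borel_measurable borel" "g \<in> borel_measurable borel"
  shows "convolution K g \<in> borel_measurable borel"
  unfolding convolution_def[abs_def] by measurable

lemma convolution_nonneg:
  assumes "\<And>s. 0 \<le> K s" "\<And>s. 0 \<le> g s"
  shows "0 \<le> convolution K g t"
  unfolding convolution_def using assms by (auto intro!: integral_nonneg_AE)

lemma convolution_integrable:
  assumes K: "integrable lborel K" and g: "integrable lborel g"
  shows "AE t in lborel. integrable lborel (\<lambda>s. K s * g (t - s))"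
    and "integrable lborel (convolution K g)"
    and "(LINT t|lborel. convolution K g t) = (LINT s|lborel. K s) * (LINT s|lborel. g s)"
proof -
  note [measurable] = K[THEN borel_measurable_integrable, simplified] g[THEN borel_measurable_integrable, simplified]
  have shift: "integrable lborel (\<lambda>t. h (t - s))" "(LINT t|lborel. h (t - s)) = (LINT t|lborel. h t)"
    if "integrable lborel h" for h :: "real \<Rightarrow> real" and s
  proof -
    show "integrable lborel (\<lambda>t. h (t - s))"
      using lborel_integrable_real_affine[OF that, of 1 "- s"] by simp
    show "(LINT t|lborel. h (t - s)) = (LINT t|lborel. h t)"
      using lborel_integral_real_affine[of 1 h "- s"] by simp
  qed
  have int: "integrable (lborel \<Otimes>\<^sub>M lborel) (\<lambda>(s, t). K s * g (t - s))"
  proof (rule lborel_pair.Fubini_integrable)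
    show "integrable lborel (\<lambda>s. LINT t|lborel. norm (case (s, t) of (s, t) \<Rightarrow> K s * g (t - s)))"
      using K g by (simp add: abs_mult shift(2)[of "\<lambda>x. \<bar>g x\<bar>"])
    show "AE s in lborel. integrable lborel (\<lambda>t. case (s, t) of (s, t) \<Rightarrow> K s * g (t - s))"
      using shift(1)[OF g] by simp
  qed measurable
  show "AE t in lborel. integrable lborel (\<lambda>s. K s * g (t - s))"
    using lborel_pair.AE_integrable_snd[OF int] by simp
  show "integrable lborel (convolution K g)"
    using lborel_pair.integrable_snd[OF int] by (simp add: convolution_def[abs_def])
  have "(LINT t|lborel. convolution K g t) = (LINT s|lborel. LINT t|lborel. K s * g (t - s))"
    using lborel_pair.Fubini_integral[OF int] by (simp add: convolution_def)
  also have "\<dots> = (LINT s|lborel. K s) * (LINT s|lborel. g s)"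
    by (simp add: shift(2)[OF g])
  finally show "(LINT t|lborel. convolution K g t) = (LINT s|lborel. K s) * (LINT s|lborel. g s)" .
qed

text \<open>
  Young's inequality comes from Hoelder's inequality with three factors, applied for fixed \<open>t\<close> to
  \<open>K\<^sup>p g\<^sup>q\<close>, \<open>K\<^sup>p\<close> and \<open>g\<^sup>q\<close> (with \<open>g\<close> evaluated at \<open>t - s\<close>) and with the weights \<open>1/r\<close>,
  \<open>1/p - 1/r\<close> and \<open>1/q - 1/r\<close>. The integral of the first function is the convolution of two
  integrable functions; in particular it is finite for almost every \<open>t\<close>.
\<close>

lemma Young_convolution:
  fixes K g :: "real \<Rightarrow> real" and p q r :: real
  assumes [measurable]: "K \<in> borel_measurable borel" "g \<in> borel_measurable borel"
    and nonneg: "\<And>s. 0 \<le> K s" "\<And>s. 0 \<le> g s"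
    and exps: "1 \<le> p" "1 \<le> q" "1 \<le> r" "1 / p + 1 / q = 1 + 1 / r"
    and K: "integrable lborel (\<lambda>s. K s powr p)" and g: "integrable lborel (\<lambda>s. g s powr q)"
  shows "AE t in lborel. integrable lborel (\<lambda>s. K s * g (t - s))"
    and "integrable lborel (\<lambda>t. convolution K g t powr r)"
    and "(LINT t|lborel. convolution K g t powr r)
           \<le> (LINT s|lborel. K s powr p) powr (r / p) * (LINT s|lborel. g s powr q) powr (r / q)"
proof -
  define A B where "A = (LINT s|lborel. K s powr p)" and "B = (LINT s|lborel. g s powr q)"
  define I where "I = convolution (\<lambda>s. K s powr p) (\<lambda>s. g s powr q)"
  have AB: "0 \<le> A" "0 \<le> B" unfolding A_def B_def by (auto intro!: integral_nonneg_AE)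
  have y: "0 \<le> 1 / p - 1 / r" and z: "0 \<le> 1 / q - 1 / r"
  proof -
    have "1 / p \<le> 1" "1 / q \<le> 1" using exps by auto
    then show "0 \<le> 1 / p - 1 / r" "0 \<le> 1 / q - 1 / r" using exps(4) by linarith+
  qed
  have Hol: "integrable lborel (\<lambda>s. K s * g (t - s)) \<and>
      convolution K g t powr r \<le> A powr (r / p - 1) * B powr (r / q - 1) * I t"
    if int: "integrable lborel (\<lambda>s. K s powr p * g (t - s) powr q)" for t
  proof -
    have g': "integrable lborel (\<lambda>s. g (t - s) powr q)" "(LINT s|lborel. g (t - s) powr q) = B"
      using lborel_integrable_real_affine[OF g, of "-1" t]
        lborel_integral_real_affine[of "-1" "\<lambda>s. g s powr q" t] by (auto simp: B_def)
    have eq: "(K s powr p * g (t - s) powr q) powr (1 / r) * (K s powr p) powr (1 / p - 1 / r)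
        * (g (t - s) powr q) powr (1 / q - 1 / r) = K s * g (t - s)" for s
    proof (cases "K s = 0 \<or> g (t - s) = 0")
      case False
      then have pos: "0 < K s" "0 < g (t - s)" using nonneg by (auto simp: less_le)
      have "K s powr (p / r) * K s powr (1 - p / r) = K s"
        "g (t - s) powr (q / r) * g (t - s) powr (1 - q / r) = g (t - s)"
        using pos by (simp_all add: powr_add[symmetric])
      moreover have "p * (1 / p - 1 / r) = 1 - p / r" "q * (1 / q - 1 / r) = 1 - q / r"
        using exps by (auto simp: field_simps)
      ultimately show ?thesis
        using pos by (simp add: powr_mult powr_powr) (metis mult.assoc mult.left_commute)
    qed auto
    note H = Holder_inequality3[OF int K g'(1), of "1 / r" "1 / p - 1 / r" "1 / q - 1 / r"]
    have i: "integrable lborel (\<lambda>s. K s * g (t - s))"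
      using H(1) y z exps unfolding eq by simp
    have "convolution K g t \<le> I t powr (1 / r) * A powr (1 / p - 1 / r) * B powr (1 / q - 1 / r)"
      using H(2) y z exps unfolding eq g'(2) A_def[symmetric]
      by (simp add: convolution_def I_def)
    then have "convolution K g t powr r \<le> (I t powr (1 / r) * A powr (1 / p - 1 / r) * B powr (1 / q - 1 / r)) powr r"
      using exps convolution_nonneg[of K g t] nonneg by (intro powr_mono2) auto
    also have "\<dots> = A powr (r / p - 1) * B powr (r / q - 1) * I t"
    proof -
      have "0 \<le> I t" unfolding I_def by (rule convolution_nonneg) auto
      moreover have "(1 / p - 1 / r) * r = r / p - 1" "(1 / q - 1 / r) * r = r / q - 1"
        using exps by (auto simp: field_simps)
      ultimately show ?thesis
        using exps by (simp add: powr_mult powr_powr)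
    qed
    finally show ?thesis using i by simp
  qed
  have bound: "AE t in lborel. integrable lborel (\<lambda>s. K s * g (t - s)) \<and>
      convolution K g t powr r \<le> A powr (r / p - 1) * B powr (r / q - 1) * I t"
    using convolution_integrable(1)[OF K g] by eventually_elim (rule Hol)
  then show "AE t in lborel. integrable lborel (\<lambda>s. K s * g (t - s))"
    by auto
  have I: "integrable lborel (\<lambda>t. A powr (r / p - 1) * B powr (r / q - 1) * I t)"
    using convolution_integrable(2)[OF K g] by (simp add: I_def)
  show int: "integrable lborel (\<lambda>t. convolution K g t powr r)"
  proof (rule Bochner_Integration.integrable_bound[OF I])
    show "AE t in lborel. norm (convolution K g t powr r) \<le> norm (A powr (r / p - 1) * B powr (r / q - 1) * I t)"
      using bound by eventually_elim auto
  qed measurable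
  have "(LINT t|lborel. convolution K g t powr r)
      \<le> (LINT t|lborel. A powr (r / p - 1) * B powr (r / q - 1) * I t)"
    using bound by (intro integral_mono_AE int I) auto
  also have "\<dots> = (A powr (r / p - 1) * A) * (B powr (r / q - 1) * B)"
    using convolution_integrable(3)[OF K g] by (simp add: I_def A_def B_def)
  also have "\<dots> = A powr (r / p) * B powr (r / q)"
  proof -
    have "a powr (e - 1) * a = a powr e" if "0 \<le> a" for a e :: real
      using that by (cases "a = 0") (auto simp: powr_diff)
    then show ?thesis using AB by simp
  qed
  finally show "(LINT t|lborel. convolution K g t powr r)
           \<le> (LINT s|lborel. K s powr p) powr (r / p) * (LINT s|lborel. g s powr q) powr (r / q)"
    by (simp add: A_def B_def)
qed

section \<open>Strong and weak limits in Lebesgue spaces\<close>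

lemma dominated_convergence_at_right:
  fixes s :: "real \<Rightarrow> 'a \<Rightarrow> real"
  assumes meas: "f \<in> borel_measurable M" "\<And>\<tau>. 0 < \<tau> \<Longrightarrow> s \<tau> \<in> borel_measurable M"
    and w: "integrable M w"
    and lim: "AE x in M. ((\<lambda>\<tau>. s \<tau> x) \<longlongrightarrow> f x) (at_right 0)"
    and bound: "\<And>\<tau>. 0 < \<tau> \<Longrightarrow> AE x in M. norm (s \<tau> x) \<le> w x"
  shows "((\<lambda>\<tau>. LINT x|M. s \<tau> x) \<longlongrightarrow> (LINT x|M. f x)) (at_right 0)"
  unfolding tendsto_at_iff_sequentially
proof (intro allI impI)
  fix X :: "nat \<Rightarrow> real"
  assume X: "\<forall>i. X i \<in> {0<..} - {0}" "X \<longlonglongrightarrow> 0"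
  then have pos: "0 < X i" for i by auto
  have "AE x in M. (\<lambda>i. s (X i) x) \<longlonglongrightarrow> f x"
    using lim
  proof eventually_elim
    case (elim x)
    then show ?case
      using X unfolding tendsto_at_iff_sequentially by (auto simp: o_def)
  qed
  then have "(\<lambda>i. LINT x|M. s (X i) x) \<longlonglongrightarrow> (LINT x|M. f x)"
    using pos by (intro integral_dominated_convergence[OF meas(1) meas(2) w _ bound])
  then show "((\<lambda>\<tau>. LINT x|M. s \<tau> x) \<circ> X) \<longlonglongrightarrow> (LINT x|M. f x)"
    by (simp add: o_def)
qed

lemma abs_add3_powr_le:
  fixes a b c :: real
  assumes "0 \<le> p"
  shows "\<bar>a + b + c\<bar> powr p \<le> 3 powr p * (\<bar>a\<bar> powr p + \<bar>b\<bar> powr p + \<bar>c\<bar> powr p)"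
proof -
  have "\<bar>a + b + c\<bar> powr p \<le> (3 * max \<bar>a\<bar> (max \<bar>b\<bar> \<bar>c\<bar>)) powr p"
    using assms by (intro powr_mono2) auto
  also have "\<dots> = 3 powr p * max \<bar>a\<bar> (max \<bar>b\<bar> \<bar>c\<bar>) powr p"
    by (simp add: powr_mult)
  also have "\<dots> \<le> 3 powr p * (\<bar>a\<bar> powr p + \<bar>b\<bar> powr p + \<bar>c\<bar> powr p)"
    by (intro mult_left_mono) (auto simp: max_def)
  finally show ?thesis .
qed

lemma abs_add_powr_le:
  fixes a b :: real
  assumes "0 \<le> p"
  shows "\<bar>a + b\<bar> powr p \<le> 3 powr p * (\<bar>a\<bar> powr p + \<bar>b\<bar> powr p)"
  using abs_add3_powr_le[OF assms, of a b 0] by simp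

lemma Lp_space_add:
  assumes p: "0 \<le> p" and u: "u \<in> Lp_space p M" and v: "v \<in> Lp_space p M"
  shows "(\<lambda>x. u x + v x) \<in> Lp_space p M"
proof -
  have [measurable]: "u \<in> borel_measurable M" "v \<in> borel_measurable M"
    using u v by (auto simp: Lp_space_def)
  have "integrable M (\<lambda>x. \<bar>u x + v x\<bar> powr p)"
  proof (rule Bochner_Integration.integrable_bound)
    show "integrable M (\<lambda>x. 3 powr p * (\<bar>u x\<bar> powr p + \<bar>v x\<bar> powr p))"
      using u v by (auto simp: Lp_space_def)
    show "AE x in M. norm (\<bar>u x + v x\<bar> powr p) \<le> norm (3 powr p * (\<bar>u x\<bar> powr p + \<bar>v x\<bar> powr p))"
      using abs_add_powr_le[OF p] by (intro AE_I2) simp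
  qed measurable
  then show ?thesis by (simp add: Lp_space_def)
qed

lemma Lp_space_cmult:
  assumes "u \<in> Lp_space p M"
  shows "(\<lambda>x. c * u x) \<in> Lp_space p M"
  using assms by (auto simp: Lp_space_def abs_mult powr_mult)

lemma Lp_space_diff:
  assumes "0 \<le> p" "u \<in> Lp_space p M" "v \<in> Lp_space p M"
  shows "(\<lambda>x. u x - v x) \<in> Lp_space p M"
  using Lp_space_add[OF assms(1,2) Lp_space_cmult[OF assms(3), of "-1"]] by simp

lemma Lp_strong_limit_iff:
  assumes "0 < p"
  shows "Lp_strong_limit p M u v \<longleftrightarrow>
    (\<forall>\<tau>>0. u \<tau> \<in> Lp_space p M) \<and> v \<in> Lp_space p M \<and>
    ((\<lambda>\<tau>. LINT x|M. \<bar>u \<tau> x - v x\<bar> powr p) \<longlongrightarrow> 0) (at_right 0)"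
proof -
  define I where "I \<tau> = (LINT x|M. \<bar>u \<tau> x - v x\<bar> powr p)" for \<tau>
  have ge: "0 \<le> I \<tau>" for \<tau> unfolding I_def by (auto intro!: integral_nonneg_AE)
  have "((\<lambda>\<tau>. I \<tau> powr (1 / p)) \<longlongrightarrow> 0) (at_right 0) \<longleftrightarrow> (I \<longlongrightarrow> 0) (at_right 0)"
  proof
    assume "((\<lambda>\<tau>. I \<tau> powr (1 / p)) \<longlongrightarrow> 0) (at_right 0)"
    then have "((\<lambda>\<tau>. (I \<tau> powr (1 / p)) powr p) \<longlongrightarrow> 0) (at_right 0)"
      by (rule tendsto_zero_powrI[OF _ tendsto_const]) (use assms in auto)
    then show "(I \<longlongrightarrow> 0) (at_right 0)"
      using assms ge by (simp add: powr_powr)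
  next
    assume "(I \<longlongrightarrow> 0) (at_right 0)"
    then show "((\<lambda>\<tau>. I \<tau> powr (1 / p)) \<longlongrightarrow> 0) (at_right 0)"
      using assms ge by (intro tendsto_zero_powrI[OF _ tendsto_const]) auto
  qed
  then show ?thesis
    by (simp add: Lp_strong_limit_def Lp_norm_def I_def[abs_def])
qed

text \<open>
  Linearity reduces the claim to \<open>\<phi>\<close> of the differences \<open>u \<tau> - v\<close>, which the bound on \<open>\<phi>\<close> controls.
\<close>

lemma Lp_weak_limit_if_strong_limit:
  assumes p: "1 \<le> p" and strong: "Lp_strong_limit p M u v"
  shows "Lp_weak_limit p M u v"
  unfolding Lp_weak_limit_def
proof (intro conjI ballI)
  show u: "\<forall>\<tau>>0. u \<tau> \<in> Lp_space p M" and v: "v \<in> Lp_space p M"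
    using strong by (auto simp: Lp_strong_limit_def)
  fix \<phi> assume \<phi>: "\<phi> \<in> Lp_dual p M"
  then obtain C where C: "\<forall>w\<in>Lp_space p M. \<bar>\<phi> w\<bar> \<le> C * Lp_norm p M w"
    unfolding Lp_dual_def by blast
  have diff: "\<phi> (\<lambda>x. u \<tau> x - v x) = \<phi> (u \<tau>) - \<phi> v" if "0 < \<tau>" for \<tau>
  proof -
    have add: "\<phi> (\<lambda>x. w x + w' x) = \<phi> w + \<phi> w'" if "w \<in> Lp_space p M" "w' \<in> Lp_space p M" for w w'
      using \<phi> that by (simp add: Lp_dual_def)
    have cmult: "\<phi> (\<lambda>x. c * v x) = c * \<phi> v" for c
      using \<phi> v by (simp add: Lp_dual_def)
    show ?thesis
      using add[of "u \<tau>" "\<lambda>x. (-1) * v x"] u that Lp_space_cmult[OF v, of "-1"] cmult[of "-1"]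
      by simp
  qed
  have "((\<lambda>\<tau>. \<phi> (u \<tau>) - \<phi> v) \<longlongrightarrow> 0) (at_right 0)"
  proof (rule Lim_null_comparison)
    show "\<forall>\<^sub>F \<tau> in at_right 0. norm (\<phi> (u \<tau>) - \<phi> v) \<le> C * Lp_norm p M (\<lambda>x. u \<tau> x - v x)"
      using eventually_at_right_less[of 0]
    proof eventually_elim
      case (elim \<tau>)
      then show ?case
        using bspec[OF C Lp_space_diff[of p "u \<tau>" M v]] u v p diff[of \<tau>] by simp
    qed
    show "((\<lambda>\<tau>. C * Lp_norm p M (\<lambda>x. u \<tau> x - v x)) \<longlongrightarrow> 0) (at_right 0)"
      using strong by (intro tendsto_mult_right_zero) (simp add: Lp_strong_limit_def)
  qed
  then show "((\<lambda>\<tau>. \<phi> (u \<tau>)) \<longlongrightarrow> \<phi> v) (at_right 0)"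
    by (rule LIM_zero_cancel)
qed

text \<open>
  Hoelder's inequality against the constant function \<open>1\<close>; the third weight is \<open>0\<close>.
\<close>

lemma (in finite_measure) Lp_exponent_mono:
  assumes rs: "1 \<le> r" "r \<le> s" and u: "u \<in> Lp_space s M"
  shows "u \<in> Lp_space r M"
    and "(LINT x|M. \<bar>u x\<bar> powr r)
           \<le> (LINT x|M. \<bar>u x\<bar> powr s) powr (r / s) * measure M (space M) powr (1 - r / s)"
proof -
  have int: "integrable M (\<lambda>x. \<bar>u x\<bar> powr s)" and [measurable]: "u \<in> borel_measurable M"
    using u by (auto simp: Lp_space_def)
  have eq: "(\<bar>u x\<bar> powr s) powr (r / s) * 1 powr (1 - r / s) * 1 powr 0 = \<bar>u x\<bar> powr r" for x
    using rs by (simp add: powr_powr)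
  note H = Holder_inequality3[OF int, of "\<lambda>_. 1" "\<lambda>_. 1" "r / s" "1 - r / s" 0, unfolded eq]
  show "u \<in> Lp_space r M"
    using H(1) rs by (simp add: Lp_space_def)
  have "(LINT x|M. \<bar>u x\<bar> powr r)
      \<le> (LINT x|M. \<bar>u x\<bar> powr s) powr (r / s) * measure M (space M) powr (1 - r / s) * measure M (space M) powr 0"
    using H(2) rs by simp
  also have "\<dots> \<le> (LINT x|M. \<bar>u x\<bar> powr s) powr (r / s) * measure M (space M) powr (1 - r / s)"
    by simp
  finally show "(LINT x|M. \<bar>u x\<bar> powr r)
           \<le> (LINT x|M. \<bar>u x\<bar> powr s) powr (r / s) * measure M (space M) powr (1 - r / s)" .
qed

lemma (in finite_measure) Lp_strong_limit_exponent_mono: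
  assumes rs: "1 \<le> r" "r \<le> s" and lim: "Lp_strong_limit s M u v"
  shows "Lp_strong_limit r M u v"
proof -
  have u: "\<And>\<tau>. 0 < \<tau> \<Longrightarrow> u \<tau> \<in> Lp_space s M"
    and v: "v \<in> Lp_space s M"
    and I: "((\<lambda>\<tau>. LINT x|M. \<bar>u \<tau> x - v x\<bar> powr s) \<longlongrightarrow> 0) (at_right 0)"
    using lim rs by (auto simp: Lp_strong_limit_iff)
  have "((\<lambda>\<tau>. LINT x|M. \<bar>u \<tau> x - v x\<bar> powr r) \<longlongrightarrow> 0) (at_right 0)"
  proof (rule Lim_null_comparison)
    show "\<forall>\<^sub>F \<tau> in at_right 0. norm (LINT x|M. \<bar>u \<tau> x - v x\<bar> powr r)
        \<le> (LINT x|M. \<bar>u \<tau> x - v x\<bar> powr s) powr (r / s) * measure M (space M) powr (1 - r / s)"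
      using eventually_at_right_less[of 0]
    proof eventually_elim
      case (elim \<tau>)
      then have "(\<lambda>x. u \<tau> x - v x) \<in> Lp_space s M"
        using u v rs by (intro Lp_space_diff) auto
      from Lp_exponent_mono(2)[OF rs this] show ?case
        by (simp add: integral_nonneg_AE)
    qed
    show "((\<lambda>\<tau>. (LINT x|M. \<bar>u \<tau> x - v x\<bar> powr s) powr (r / s) * measure M (space M) powr (1 - r / s)) \<longlongrightarrow> 0) (at_right 0)"
      using rs by (intro tendsto_mult_left_zero tendsto_zero_powrI[OF I tendsto_const])
        (auto intro!: integral_nonneg_AE)
  qed
  then show ?thesis
    using u v rs Lp_exponent_mono(1)[OF rs] by (simp add: Lp_strong_limit_iff)
qed

section \<open>Borel representatives on an interval\<close>

lemma integrable_lebesgue_on_iff: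
  fixes h :: "real \<Rightarrow> real"
  assumes "h \<in> borel_measurable borel"
  shows "integrable (lebesgue_on {0<..<T}) h \<longleftrightarrow> integrable lborel (\<lambda>x. indicator {0<..<T} x * h x)"
    and "(LINT x|lebesgue_on {0<..<T}. h x) = (LINT x|lborel. indicator {0<..<T} x * h x)"
  using assms by (simp_all add: integrable_restrict_space integral_restrict_space
      integrable_completion integral_completion)

text \<open>
  The function \<open>F\<close> inherits measurability from \<open>G\<close> because Lebesgue measure is complete.
\<close>

lemma integral_lebesgue_eq_lborel:
  fixes F G :: "real \<Rightarrow> real"
  assumes G: "G \<in> borel_measurable borel" and eq: "AE x in lborel. F x = G x"
  shows "(LINT x|lebesgue. F x) = (LINT x|lborel. G x)"
proof -
  have G': "G \<in> borel_measurable lebesgue"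
    using G by (simp add: measurable_completion)
  have eq': "AE x in lebesgue. G x = F x"
    using AE_completion[OF eq] by auto
  have "(LINT x|lebesgue. F x) = (LINT x|lebesgue. G x)"
    using borel_measurable_AE[OF G' eq'] G' eq' by (intro integral_cong_AE) auto
  also have "\<dots> = (LINT x|lborel. G x)"
    using G by (intro integral_completion) simp
  finally show ?thesis .
qed

text \<open>
  Convolutions involve \<open>f (t - s)\<close> as a function of two variables. For a Lebesgue measurable \<open>f\<close> this
  may fail to be measurable for the product of the Lebesgue sigma-algebras, hence the passage to Borel functions.
\<close>

lemma Borel_representative:
  fixes f :: "real \<Rightarrow> real"
  assumes "f \<in> borel_measurable (lebesgue_on {0<..<T})"
  obtains g where "g \<in> borel_measurable borel" "\<And>x. x \<notin> {0<..<T} \<Longrightarrow> g x = 0"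
    "AE x in lborel. x \<in> {0<..<T} \<longrightarrow> f x = g x"
proof -
  have "(\<lambda>x. indicator {0<..<T} x *\<^sub>R f x) \<in> borel_measurable lebesgue"
    using assms by (subst (asm) borel_measurable_restrict_space_iff) auto
  from completion_ex_borel_measurable_real[OF this]
  obtain h where h: "h \<in> borel_measurable lborel" "AE x in lborel. indicator {0<..<T} x *\<^sub>R f x = h x"
    by auto
  show ?thesis
  proof (rule that[of "\<lambda>x. indicator {0<..<T} x * h x"])
    show "(\<lambda>x. indicator {0<..<T} x * h x) \<in> borel_measurable borel"
      using h(1) by measurable
    show "AE x in lborel. x \<in> {0<..<T} \<longrightarrow> f x = indicator {0<..<T} x * h x"
      using h(2) by eventually_elim (auto simp: indicator_def)
  qed auto
qed

lemma Lp_Borel_representative: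
  fixes f g :: "real \<Rightarrow> real"
  assumes g[measurable]: "g \<in> borel_measurable borel" and g0: "\<And>x. x \<notin> {0<..<T} \<Longrightarrow> g x = 0"
    and eq: "AE x in lborel. x \<in> {0<..<T} \<longrightarrow> f x = g x"
    and f: "f \<in> borel_measurable (lebesgue_on {0<..<T})"
    and q: "1 \<le> q"
  shows "integrable (lebesgue_on {0<..<T}) (\<lambda>x. \<bar>f x\<bar> powr q) \<longleftrightarrow> integrable lborel (\<lambda>x. \<bar>g x\<bar> powr q)"
    and "(LINT x|lebesgue_on {0<..<T}. \<bar>f x\<bar> powr q) = (LINT x|lborel. \<bar>g x\<bar> powr q)"
proof -
  have g': "g \<in> borel_measurable (lebesgue_on {0<..<T})"
    using g by (intro measurable_restrict_space1) (simp add: measurable_completion)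
  have eq': "AE x in lebesgue_on {0<..<T}. \<bar>f x\<bar> powr q = \<bar>g x\<bar> powr q"
    using AE_completion[OF eq] by (subst AE_restrict_space_iff) (auto elim!: eventually_mono)
  have supp: "indicator {0<..<T} x * \<bar>g x\<bar> powr q = \<bar>g x\<bar> powr q" for x
    using g0[of x] by (auto simp: indicator_def)
  have "integrable (lebesgue_on {0<..<T}) (\<lambda>x. \<bar>f x\<bar> powr q)
      \<longleftrightarrow> integrable (lebesgue_on {0<..<T}) (\<lambda>x. \<bar>g x\<bar> powr q)"
    using f g' eq' by (intro integrable_cong_AE) auto
  also have "\<dots> \<longleftrightarrow> integrable lborel (\<lambda>x. \<bar>g x\<bar> powr q)"
    by (subst integrable_lebesgue_on_iff) (auto simp: supp)
  finally show "integrable (lebesgue_on {0<..<T}) (\<lambda>x. \<bar>f x\<bar> powr q) \<longleftrightarrow> integrable lborel (\<lambda>x. \<bar>g x\<bar> powr q)" .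
  have "(LINT x|lebesgue_on {0<..<T}. \<bar>f x\<bar> powr q) = (LINT x|lebesgue_on {0<..<T}. \<bar>g x\<bar> powr q)"
    using f g' eq' by (intro integral_cong_AE) auto
  also have "\<dots> = (LINT x|lborel. \<bar>g x\<bar> powr q)"
    by (subst integrable_lebesgue_on_iff) (auto simp: supp)
  finally show "(LINT x|lebesgue_on {0<..<T}. \<bar>f x\<bar> powr q) = (LINT x|lborel. \<bar>g x\<bar> powr q)" .
qed

lemma Lp_space_lebesgue_onI:
  fixes w k :: "real \<Rightarrow> real"
  assumes w: "\<And>t. t \<in> {0<..<T} \<Longrightarrow> w t = k t" and k: "k \<in> borel_measurable borel"
    and int: "integrable lborel (\<lambda>t. \<bar>k t\<bar> powr p)"
  shows "w \<in> Lp_space p (lebesgue_on {0<..<T})"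
proof -
  let ?M = "lebesgue_on {0<..<T}"
  have "integrable lborel (\<lambda>s. indicator {0<..<T} s * \<bar>k s\<bar> powr p)"
    using integrable_real_mult_indicator[OF _ int, of "{0<..<T}"] by (simp add: mult.commute)
  then have "integrable ?M (\<lambda>s. \<bar>k s\<bar> powr p)"
    using k by (subst integrable_lebesgue_on_iff) auto
  moreover have "k \<in> borel_measurable ?M"
    using k by (intro measurable_restrict_space1) (simp add: measurable_completion)
  moreover have "w \<in> borel_measurable ?M \<longleftrightarrow> k \<in> borel_measurable ?M"
    by (intro measurable_cong) (simp add: w)
  moreover have "integrable ?M (\<lambda>x. \<bar>w x\<bar> powr p) \<longleftrightarrow> integrable ?M (\<lambda>x. \<bar>k x\<bar> powr p)"
    by (intro Bochner_Integration.integrable_cong refl) (simp add: w)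
  ultimately show ?thesis by (simp add: Lp_space_def)
qed

lemma AE_reflect:
  assumes "AE x in lborel. P (x::real)"
  shows "AE s in lborel. P (t - s)"
proof -
  obtain N where N: "N \<in> null_sets lborel" "{x \<in> space lborel. \<not> P x} \<subseteq> N"
    using assms by (auto simp: eventually_ae_filter)
  have "AE x in lborel. x \<notin> N" using N(1) by (rule AE_not_in)
  then have "AE s in lborel. t + (-1) * s \<notin> N"
    using N(1) by (intro AE_borel_affine) auto
  then show ?thesis
  proof eventually_elim
    case (elim s)
    then show ?case using N(2) by auto
  qed
qed

section \<open>Convergence of the rescaled weights\<close>

locale fractional_kernels = fractional_weights +
  fixes T :: real
begin

text \<open>
  The kernels are cut off outside \<open>{0<..<T}\<close>, which does not change their convolutions
  on this interval with data that live there, and makes the kernels \<open>p\<close>-integrable on the whole line.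
\<close>

definition majorant :: "real \<Rightarrow> real" where
  "majorant s = indicator {0<..<T} s * s powr (- \<alpha>)"

definition limit_kernel :: "real \<Rightarrow> real" where
  "limit_kernel s = 1 / (Gamma \<alpha> * Gamma (1 - \<alpha>)) * majorant s"

definition step_kernel :: "real \<Rightarrow> real \<Rightarrow> real" where
  "step_kernel \<tau> s = indicator {0<..<T} s * (\<tau> powr (- \<alpha>) * lam (nat \<lceil>s / \<tau>\<rceil>))"

lemma Gamma_prod_pos: "0 < Gamma \<alpha> * Gamma (1 - \<alpha>)"
  using \<alpha>_pos \<alpha>_less by (intro mult_pos_pos Gamma_real_pos) auto

lemma borel_measurable_kernels [measurable]:
  "majorant \<in> borel_measurable borel"
  "limit_kernel \<in> borel_measurable borel"
  "step_kernel \<tau> \<in> borel_measurable borel"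
  unfolding majorant_def[abs_def] limit_kernel_def[abs_def] step_kernel_def[abs_def] by measurable

lemma majorant_nonneg: "0 \<le> majorant s"
  by (simp add: majorant_def)

lemma limit_kernel_nonneg: "0 \<le> limit_kernel s"
  using Gamma_prod_pos majorant_nonneg by (simp add: limit_kernel_def)

lemma step_kernel_bounds:
  assumes "0 < \<tau>"
  shows "0 \<le> step_kernel \<tau> s" "step_kernel \<tau> s \<le> majorant s"
proof -
  have "0 \<le> \<tau> powr (- \<alpha>) * lam (nat \<lceil>s / \<tau>\<rceil>) \<and> \<tau> powr (- \<alpha>) * lam (nat \<lceil>s / \<tau>\<rceil>) \<le> s powr (- \<alpha>)"
    if "0 < s"
  proof -
    define k where "k = nat \<lceil>s / \<tau>\<rceil>"
    have "0 < s / \<tau>" using assms that by simp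
    moreover have k: "s / \<tau> \<le> real k" by (simp add: k_def real_nat_ceiling_ge)
    ultimately have k1: "1 \<le> k" by (cases k) auto
    have "\<tau> powr (- \<alpha>) * lam k \<le> \<tau> powr (- \<alpha>) * (s / \<tau>) powr (- \<alpha>)"
      using lam_le[OF k1] powr_mono2'[of "- \<alpha>" "s / \<tau>" "real k"] \<open>0 < s / \<tau>\<close> k \<alpha>_pos
      by (intro mult_left_mono) auto
    also have "\<dots> = s powr (- \<alpha>)"
      using assms by (simp add: powr_divide)
    finally show ?thesis
      using lam_pos[OF k1] by (simp add: k_def)
  qed
  then show "0 \<le> step_kernel \<tau> s" "step_kernel \<tau> s \<le> majorant s"
    by (auto simp: step_kernel_def majorant_def indicator_def)
qed

text \<open>
  With \<open>k = \<lceil>s / \<tau>\<rceil>\<close>, the value \<open>\<tau> powr (- \<alpha>) * lam k\<close> is \<open>lam k * k powr \<alpha>\<close>, which converges by the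
  asymptotics of the weights, times \<open>(\<tau> * k) powr (- \<alpha>)\<close>, where \<open>\<tau> * k\<close> tends to \<open>s\<close>.
\<close>

lemma step_kernel_tendsto: "((\<lambda>\<tau>. step_kernel \<tau> s) \<longlongrightarrow> limit_kernel s) (at_right 0)"
proof (cases "s \<in> {0<..<T}")
  case True
  then have s: "0 < s" by simp
  define k where "k \<tau> = nat \<lceil>s / \<tau>\<rceil>" for \<tau>
  have k_ge: "s \<le> \<tau> * real (k \<tau>)" and k_le: "\<tau> * real (k \<tau>) \<le> s + \<tau>" if "0 < \<tau>" for \<tau>
  proof -
    have "s / \<tau> \<le> real (k \<tau>)" by (simp add: k_def real_nat_ceiling_ge)
    then show "s \<le> \<tau> * real (k \<tau>)" using that by (simp add: field_simps)
    have "0 < s / \<tau>" using s that by simp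
    then have "real (k \<tau>) \<le> s / \<tau> + 1" unfolding k_def by linarith
    then show "\<tau> * real (k \<tau>) \<le> s + \<tau>" using that by (simp add: field_simps)
  qed
  have \<tau>k: "((\<lambda>\<tau>. \<tau> * real (k \<tau>)) \<longlongrightarrow> s) (at_right 0)"
  proof (rule tendsto_sandwich)
    show "\<forall>\<^sub>F \<tau> in at_right 0. s \<le> \<tau> * real (k \<tau>)"
      using eventually_at_right_less[of 0] by eventually_elim (rule k_ge)
    show "\<forall>\<^sub>F \<tau> in at_right 0. \<tau> * real (k \<tau>) \<le> s + \<tau>"
      using eventually_at_right_less[of 0] by eventually_elim (rule k_le)
    have "((\<lambda>\<tau>. s + \<tau>) \<longlongrightarrow> s + 0) (at_right 0)" by (intro tendsto_intros)
    then show "((\<lambda>\<tau>. s + \<tau>) \<longlongrightarrow> s) (at_right 0)" by simp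
  qed simp
  have k_top: "filterlim k at_top (at_right 0)"
    unfolding filterlim_at_top
  proof
    fix Z :: nat
    have "\<forall>\<^sub>F \<tau> in at_right 0. \<tau> < s / (real Z + 1)"
      using s by (intro eventually_mono[OF eventually_at_right_real[of 0 "s / (real Z + 1)"]]) auto
    then show "\<forall>\<^sub>F \<tau> in at_right 0. Z \<le> k \<tau>"
      using eventually_at_right_less[of 0]
    proof eventually_elim
      case (elim \<tau>)
      then have "\<tau> * (real Z + 1) < s" by (simp add: field_simps)
      also have "s \<le> \<tau> * real (k \<tau>)" using elim by (intro k_ge)
      finally have "real Z + 1 < real (k \<tau>)" using elim by simp
      then show ?case by simp
    qed
  qed
  have "((\<lambda>\<tau>. lam (k \<tau>) * real (k \<tau>) powr \<alpha> * (\<tau> * real (k \<tau>)) powr (- \<alpha>))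
      \<longlongrightarrow> 1 / (Gamma \<alpha> * Gamma (1 - \<alpha>)) * s powr (- \<alpha>)) (at_right 0)"
    using s by (intro tendsto_intros \<tau>k filterlim_compose[OF lam_asymptotics k_top]) auto
  moreover have "\<forall>\<^sub>F \<tau> in at_right 0.
      lam (k \<tau>) * real (k \<tau>) powr \<alpha> * (\<tau> * real (k \<tau>)) powr (- \<alpha>) = step_kernel \<tau> s"
    using eventually_at_right_less[of 0]
  proof eventually_elim
    case (elim \<tau>)
    have "0 < \<tau> * real (k \<tau>)" using k_ge[OF elim] s by linarith
    then have "0 < real (k \<tau>)" using elim by (simp add: zero_less_mult_iff)
    then show ?case
      using True by (simp add: step_kernel_def k_def[symmetric] powr_mult powr_minus)
  qed
  ultimately show ?thesis
    using True by (auto simp: limit_kernel_def majorant_def intro: Lim_transform_eventually)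
qed (auto simp: step_kernel_def limit_kernel_def majorant_def)

context
  fixes p :: real
  assumes p: "1 \<le> p" "p < 1 / \<alpha>"
begin

lemma majorant_integrable: "integrable lborel (\<lambda>s. majorant s powr p)"
proof (cases "0 < T")
  case True
  have "- (\<alpha> * p) > -1" using p \<alpha>_pos by (simp add: field_simps)
  then have "set_integrable lborel {0<..<T} (\<lambda>x. x powr (- (\<alpha> * p)))"
    using True by (intro set_integrable_powr_from_0) auto
  then have "integrable lborel (\<lambda>x. indicator {0<..<T} x * x powr (- (\<alpha> * p)))"
    by (simp add: set_integrable_def)
  also have "(\<lambda>x. indicator {0<..<T} x * x powr (- (\<alpha> * p))) = (\<lambda>s. majorant s powr p)"
    using p by (auto simp: majorant_def indicator_def powr_powr)
  finally show ?thesis .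
qed (simp add: majorant_def)

lemma limit_kernel_integrable: "integrable lborel (\<lambda>s. limit_kernel s powr p)"
proof -
  have "integrable lborel (\<lambda>s. (1 / (Gamma \<alpha> * Gamma (1 - \<alpha>))) powr p * majorant s powr p)"
    by (intro integrable_mult_right majorant_integrable)
  then show ?thesis
    by (simp only: limit_kernel_def powr_mult)
qed

lemma step_kernel_integrable:
  assumes "0 < \<tau>"
  shows "integrable lborel (\<lambda>s. step_kernel \<tau> s powr p)"
proof (rule Bochner_Integration.integrable_bound[OF majorant_integrable])
  show "AE s in lborel. norm (step_kernel \<tau> s powr p) \<le> norm (majorant s powr p)"
    using step_kernel_bounds[OF assms] p by (intro AE_I2) (auto intro!: powr_mono2)
qed measurable

lemma kernel_diff_bound:
  assumes "0 < \<tau>"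
  shows "\<bar>step_kernel \<tau> s - limit_kernel s\<bar>
           \<le> (1 + 1 / (Gamma \<alpha> * Gamma (1 - \<alpha>))) * majorant s"
  using step_kernel_bounds[OF assms, of s] limit_kernel_nonneg[of s]
  by (simp add: limit_kernel_def algebra_simps)

lemma kernel_diff_powr_bound:
  assumes "0 < \<tau>"
  shows "\<bar>step_kernel \<tau> s - limit_kernel s\<bar> powr p
           \<le> (1 + 1 / (Gamma \<alpha> * Gamma (1 - \<alpha>))) powr p * majorant s powr p"
proof -
  have "\<bar>step_kernel \<tau> s - limit_kernel s\<bar> powr p
      \<le> ((1 + 1 / (Gamma \<alpha> * Gamma (1 - \<alpha>))) * majorant s) powr p"
    using p by (intro powr_mono2 kernel_diff_bound assms) auto
  then show ?thesis
    using Gamma_prod_pos majorant_nonneg by (simp add: powr_mult)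
qed

lemma kernel_diff_integrable:
  assumes "0 < \<tau>"
  shows "integrable lborel (\<lambda>s. \<bar>step_kernel \<tau> s - limit_kernel s\<bar> powr p)"
proof (rule Bochner_Integration.integrable_bound)
  show "integrable lborel (\<lambda>s. (1 + 1 / (Gamma \<alpha> * Gamma (1 - \<alpha>))) powr p * majorant s powr p)"
    by (intro integrable_mult_right majorant_integrable)
qed (use kernel_diff_powr_bound[OF assms] in auto)

lemma step_kernel_tendsto_Lp:
  "((\<lambda>\<tau>. LINT s|lborel. \<bar>step_kernel \<tau> s - limit_kernel s\<bar> powr p) \<longlongrightarrow> 0) (at_right 0)"
proof -
  have "((\<lambda>\<tau>. LINT s|lborel. \<bar>step_kernel \<tau> s - limit_kernel s\<bar> powr p)
      \<longlongrightarrow> (LINT s|(lborel::real measure). (0::real))) (at_right 0)"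
  proof (rule dominated_convergence_at_right)
    show "integrable lborel (\<lambda>s. (1 + 1 / (Gamma \<alpha> * Gamma (1 - \<alpha>))) powr p * majorant s powr p)"
      by (intro integrable_mult_right majorant_integrable)
    show "AE s in lborel. ((\<lambda>\<tau>. \<bar>step_kernel \<tau> s - limit_kernel s\<bar> powr p) \<longlongrightarrow> 0) (at_right 0)"
    proof (intro AE_I2)
      fix s
      have "((\<lambda>\<tau>. \<bar>step_kernel \<tau> s - limit_kernel s\<bar>) \<longlongrightarrow> 0) (at_right 0)"
        using step_kernel_tendsto by (intro tendsto_rabs_zero LIM_zero)
      then show "((\<lambda>\<tau>. \<bar>step_kernel \<tau> s - limit_kernel s\<bar> powr p) \<longlongrightarrow> 0) (at_right 0)"
        by (rule tendsto_zero_powrI[OF _ tendsto_const]) (use p in auto)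
    qed
  qed (use kernel_diff_powr_bound in auto)
  then show ?thesis by simp
qed

end

lemma step_function_eq_step_kernel:
  assumes "0 < \<tau>" "t \<in> {0<..<T}"
  shows "\<tau> powr (- \<alpha>) * (\<Sum>\<^sub>\<infinity>k\<in>{1..}. lam k * indicator (mesh_cell \<tau> k) t) = step_kernel \<tau> t"
proof -
  have "0 < \<lceil>t / \<tau>\<rceil>" using assms by simp
  then have "nat \<lceil>t / \<tau>\<rceil> \<in> {1..}" by (simp only: atLeast_iff)
  then have "(\<Sum>\<^sub>\<infinity>k\<in>{1..}. lam k * indicator (mesh_cell \<tau> k) t)
      = (\<Sum>\<^sub>\<infinity>k\<in>{nat \<lceil>t / \<tau>\<rceil>}. lam k)"
    using assms by (intro infsum_cong_neutral) (auto simp: mem_mesh_cell_iff indicator_def)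
  then show ?thesis
    using assms by (simp add: step_kernel_def)
qed

lemma step_function_strong_limit:
  assumes p: "1 \<le> p" "p < 1 / \<alpha>"
  shows "Lp_strong_limit p (lebesgue_on {0<..<T})
           (\<lambda>\<tau> t. \<tau> powr (- \<alpha>) * (\<Sum>\<^sub>\<infinity>k\<in>{1..}. lam k * indicator (mesh_cell \<tau> k) t))
           (\<lambda>t. t powr (- \<alpha>) / (Gamma \<alpha> * Gamma (1 - \<alpha>)))"
proof -
  let ?M = "lebesgue_on {0<..<T}"
  define u where "u \<tau> t = \<tau> powr (- \<alpha>) * (\<Sum>\<^sub>\<infinity>k\<in>{1..}. lam k * indicator (mesh_cell \<tau> k) t)" for \<tau> t
  define v where "v t = t powr (- \<alpha>) / (Gamma \<alpha> * Gamma (1 - \<alpha>))" for t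
  have u: "u \<tau> t = step_kernel \<tau> t" if "0 < \<tau>" "t \<in> {0<..<T}" for \<tau> t
    using that step_function_eq_step_kernel by (simp add: u_def)
  have v: "v t = limit_kernel t" if "t \<in> {0<..<T}" for t
    using that by (simp add: v_def limit_kernel_def majorant_def)
  have "(LINT t|?M. \<bar>u \<tau> t - v t\<bar> powr p) = (LINT s|lborel. \<bar>step_kernel \<tau> s - limit_kernel s\<bar> powr p)"
    if "0 < \<tau>" for \<tau>
  proof -
    have "(LINT t|?M. \<bar>u \<tau> t - v t\<bar> powr p) = (LINT t|?M. \<bar>step_kernel \<tau> t - limit_kernel t\<bar> powr p)"
      using that by (intro Bochner_Integration.integral_cong refl) (simp add: u v)
    also have "\<dots> = (LINT s|lborel. indicator {0<..<T} s * \<bar>step_kernel \<tau> s - limit_kernel s\<bar> powr p)"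
      by (subst integrable_lebesgue_on_iff) auto
    also have "\<dots> = (LINT s|lborel. \<bar>step_kernel \<tau> s - limit_kernel s\<bar> powr p)"
      by (intro Bochner_Integration.integral_cong refl)
        (auto simp: step_kernel_def limit_kernel_def majorant_def indicator_def)
    finally show ?thesis .
  qed
  then have "((\<lambda>\<tau>. LINT t|?M. \<bar>u \<tau> t - v t\<bar> powr p) \<longlongrightarrow> 0) (at_right 0)"
    using step_kernel_tendsto_Lp[OF p]
    by (subst tendsto_cong) (auto intro: eventually_mono[OF eventually_at_right_less[of 0]])
  moreover have "u \<tau> \<in> Lp_space p ?M" if "0 < \<tau>" for \<tau>
    using that step_kernel_integrable[OF p that] step_kernel_bounds(1)[OF that]
    by (intro Lp_space_lebesgue_onI[where k = "step_kernel \<tau>"] u) auto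
  moreover have "v \<in> Lp_space p ?M"
    using limit_kernel_integrable[OF p] limit_kernel_nonneg
    by (intro Lp_space_lebesgue_onI[where k = limit_kernel] v) auto
  ultimately have "Lp_strong_limit p ?M u v"
    using p by (simp add: Lp_strong_limit_iff)
  then show ?thesis by (simp add: u_def[abs_def] v_def[abs_def])
qed

end

section \<open>Convergence of the discrete convolutions\<close>

lemma Young_null:
  fixes A B :: "real \<Rightarrow> real"
  assumes "(A \<longlongrightarrow> 0) F" "\<And>\<tau>. 0 \<le> A \<tau>" "(B \<longlongrightarrow> b) F" "0 < b" "0 < x"
  shows "((\<lambda>\<tau>. A \<tau> powr x * B \<tau> powr y) \<longlongrightarrow> 0) F"
proof -
  have "((\<lambda>\<tau>. A \<tau> powr x) \<longlongrightarrow> 0) F"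
    by (rule tendsto_zero_powrI[OF _ tendsto_const]) (use assms in auto)
  moreover have "((\<lambda>\<tau>. B \<tau> powr y) \<longlongrightarrow> b powr y) F"
    using assms by (intro tendsto_powr) auto
  ultimately show ?thesis
    using tendsto_mult[of "\<lambda>\<tau>. A \<tau> powr x" 0 F "\<lambda>\<tau>. B \<tau> powr y" "b powr y"] by simp
qed

context fractional_kernels
begin

text \<open>
  The discrete convolution with the sum over the cells written as an integral against the step
  kernel. The upper limit depends on \<open>t\<close> through the last mesh point, so it is not itself a convolution.
\<close>

definition truncated_convolution :: "real \<Rightarrow> (real \<Rightarrow> real) \<Rightarrow> real \<Rightarrow> real" where
  "truncated_convolution \<tau> g t =
     (LINT s|lborel. step_kernel \<tau> s * indicator {..real (nat \<lfloor>t / \<tau>\<rfloor>) * \<tau>} s * g (t - s))"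

lemma borel_measurable_truncated_convolution [measurable]:
  assumes [measurable]: "g \<in> borel_measurable borel"
  shows "truncated_convolution \<tau> g \<in> borel_measurable borel"
proof -
  have eq: "step_kernel \<tau> s * indicator {..real (nat \<lfloor>t / \<tau>\<rfloor>) * \<tau>} s * g (t - s)
      = step_kernel \<tau> s * (if s \<le> real (nat \<lfloor>t / \<tau>\<rfloor>) * \<tau> then 1 else 0) * g (t - s)" for s t
    by (simp add: indicator_def)
  show ?thesis
    unfolding truncated_convolution_def[abs_def] eq by measurable
qed

text \<open>
  The integrands agree unless \<open>t - s\<close> lies in the null set on which \<open>f\<close> and \<open>g\<close> differ or \<open>s = t\<close>,
  where \<open>f 0\<close> is arbitrary.
\<close>

lemma discrete_convolution_eq:
  assumes \<tau>: "0 < \<tau>" and t: "t \<in> {0<..<T}"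
    and g: "g \<in> borel_measurable borel" and eq: "AE x in lborel. x \<in> {0<..<T} \<longrightarrow> f x = g x"
    and n: "n = nat \<lfloor>t / \<tau>\<rfloor>"
  shows "1 / \<tau> powr \<alpha> * (LINT s:{0..real n * \<tau>}|lebesgue.
            (\<Sum>k=1..n. lam k * indicator (mesh_cell \<tau> k) s) * f (t - s))
         = truncated_convolution \<tau> g t"
proof -
  have "0 \<le> \<lfloor>t / \<tau>\<rfloor>" using \<tau> t by simp
  then have "real n \<le> t / \<tau>" unfolding n by linarith
  then have n_le: "real n * \<tau> \<le> t" using \<tau> by (simp add: field_simps)
  have "1 / \<tau> powr \<alpha> * (LINT s:{0..real n * \<tau>}|lebesgue.
            (\<Sum>k=1..n. lam k * indicator (mesh_cell \<tau> k) s) * f (t - s))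
      = (LINT s|lebesgue. 1 / \<tau> powr \<alpha> * (indicator {0..real n * \<tau>} s *
            ((\<Sum>k=1..n. lam k * indicator (mesh_cell \<tau> k) s) * f (t - s))))"
    by (simp add: set_lebesgue_integral_def)
  also have "\<dots> = (LINT s|lborel. step_kernel \<tau> s * indicator {..real n * \<tau>} s * g (t - s))"
  proof (rule integral_lebesgue_eq_lborel)
    show "(\<lambda>s. step_kernel \<tau> s * indicator {..real n * \<tau>} s * g (t - s)) \<in> borel_measurable borel"
      using g by measurable
    show "AE s in lborel. 1 / \<tau> powr \<alpha> * (indicator {0..real n * \<tau>} s *
            ((\<Sum>k=1..n. lam k * indicator (mesh_cell \<tau> k) s) * f (t - s)))
          = step_kernel \<tau> s * indicator {..real n * \<tau>} s * g (t - s)"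
      using AE_reflect[OF eq, of t] AE_lborel_singleton[of 0] AE_lborel_singleton[of t]
    proof eventually_elim
      case (elim s)
      show ?case
      proof (cases "0 < s \<and> s \<le> real n * \<tau>")
        case True
        then have s: "0 < s" "s < t" "s < T" using elim n_le t by auto
        then have f: "f (t - s) = g (t - s)" using elim t by auto
        have "0 < s / \<tau>" "s / \<tau> \<le> real n" using True \<tau> by (auto simp: field_simps)
        then have "0 < \<lceil>s / \<tau>\<rceil>" "\<lceil>s / \<tau>\<rceil> \<le> int n"
          by (auto simp: ceiling_le_iff)
        then have "nat \<lceil>s / \<tau>\<rceil> \<in> {1..n}" by (simp only: atLeastAtMost_iff) linarith
        moreover have "(\<Sum>k=1..n. lam k * indicator (mesh_cell \<tau> k) s)
            = (\<Sum>k=1..n. if k = nat \<lceil>s / \<tau>\<rceil> then lam k else 0)"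
          using s \<tau> by (intro sum.cong) (auto simp: mem_mesh_cell_iff indicator_def)
        ultimately have "(\<Sum>k=1..n. lam k * indicator (mesh_cell \<tau> k) s) = lam (nat \<lceil>s / \<tau>\<rceil>)"
          by simp
        then show ?thesis
          using True s f by (simp add: step_kernel_def powr_minus field_simps)
      next
        case False
        then show ?thesis
          using elim by (auto simp: step_kernel_def indicator_def)
      qed
    qed
  qed
  finally show ?thesis by (simp add: truncated_convolution_def n)
qed

lemma limit_convolution_eq:
  assumes t: "t \<in> {0<..<T}"
    and g: "g \<in> borel_measurable borel" and g0: "\<And>x. x \<notin> {0<..<T} \<Longrightarrow> g x = 0"
    and eq: "AE x in lborel. x \<in> {0<..<T} \<longrightarrow> f x = g x"
  shows "1 / (Gamma \<alpha> * Gamma (1 - \<alpha>)) * (LINT s:{0..t}|lebesgue. s powr (- \<alpha>) * f (t - s))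
         = convolution limit_kernel g t"
proof -
  have "1 / (Gamma \<alpha> * Gamma (1 - \<alpha>)) * (LINT s:{0..t}|lebesgue. s powr (- \<alpha>) * f (t - s))
      = (LINT s|lebesgue. 1 / (Gamma \<alpha> * Gamma (1 - \<alpha>)) * (indicator {0..t} s * (s powr (- \<alpha>) * f (t - s))))"
    by (simp add: set_lebesgue_integral_def)
  also have "\<dots> = (LINT s|lborel. limit_kernel s * g (t - s))"
  proof (rule integral_lebesgue_eq_lborel)
    show "(\<lambda>s. limit_kernel s * g (t - s)) \<in> borel_measurable borel"
      using g by measurable
    show "AE s in lborel. 1 / (Gamma \<alpha> * Gamma (1 - \<alpha>)) * (indicator {0..t} s * (s powr (- \<alpha>) * f (t - s)))
        = limit_kernel s * g (t - s)"
      using AE_reflect[OF eq, of t] AE_lborel_singleton[of 0] AE_lborel_singleton[of t]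
    proof eventually_elim
      case (elim s)
      show ?case
      proof (cases "0 < s \<and> s < t")
        case True
        then show ?thesis using elim t by (auto simp: limit_kernel_def majorant_def)
      next
        case False
        then have "limit_kernel s * g (t - s) = 0"
          using g0[of "t - s"] by (auto simp: limit_kernel_def majorant_def indicator_def)
        then show ?thesis
          using False elim by (auto simp: indicator_def)
      qed
    qed
  qed
  finally show ?thesis by (simp add: convolution_def)
qed

lemma truncated_convolution_le_majorant:
  assumes \<tau>: "0 < \<tau>" and [measurable]: "g \<in> borel_measurable borel"
    and int: "integrable lborel (\<lambda>s. majorant s * \<bar>g (t - s)\<bar>)"
  shows "integrable lborel (\<lambda>s. step_kernel \<tau> s * indicator {..real (nat \<lfloor>t / \<tau>\<rfloor>) * \<tau>} s * g (t - s))"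
    and "\<bar>truncated_convolution \<tau> g t\<bar> \<le> convolution majorant (\<lambda>x. \<bar>g x\<bar>) t"
proof -
  have bound: "\<bar>step_kernel \<tau> s * indicator {..real (nat \<lfloor>t / \<tau>\<rfloor>) * \<tau>} s * g (t - s)\<bar> \<le> majorant s * \<bar>g (t - s)\<bar>" for s
    using step_kernel_bounds[OF \<tau>, of s] majorant_nonneg[of s]
    by (auto simp: indicator_def abs_mult intro: mult_right_mono)
  show "integrable lborel (\<lambda>s. step_kernel \<tau> s * indicator {..real (nat \<lfloor>t / \<tau>\<rfloor>) * \<tau>} s * g (t - s))"
    using int by (rule Bochner_Integration.integrable_bound)
      (auto intro!: AE_I2 order.trans[OF bound] simp del: abs_mult)
  then show "\<bar>truncated_convolution \<tau> g t\<bar> \<le> convolution majorant (\<lambda>x. \<bar>g x\<bar>) t"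
    unfolding truncated_convolution_def convolution_def real_norm_def[symmetric]
    using int bound by (intro order.trans[OF integral_norm_bound] integral_mono integrable_norm) auto
qed

text \<open>
  For \<open>s\<close> up to the last mesh point the error is split as
  \<open>K' h - K g = (K' - K) h + K (h - g)\<close>. Beyond it only \<open>K g\<close> remains, and there \<open>t - s < \<tau>\<close>.
\<close>

lemma truncated_convolution_error:
  fixes g h :: "real \<Rightarrow> real"
  assumes \<tau>: "0 < \<tau>" and t: "0 < t"
    and [measurable]: "g \<in> borel_measurable borel" "h \<in> borel_measurable borel"
    and int: "integrable lborel (\<lambda>s. \<bar>step_kernel \<tau> s - limit_kernel s\<bar> * \<bar>h (t - s)\<bar>)"
      "integrable lborel (\<lambda>s. limit_kernel s * \<bar>h (t - s) - g (t - s)\<bar>)"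
      "integrable lborel (\<lambda>s. limit_kernel s * \<bar>g (t - s) * indicator {..<\<tau>} (t - s)\<bar>)"
      "integrable lborel (\<lambda>s. majorant s * \<bar>h (t - s)\<bar>)"
      "integrable lborel (\<lambda>s. limit_kernel s * g (t - s))"
  shows "\<bar>truncated_convolution \<tau> h t - convolution limit_kernel g t\<bar>
    \<le> convolution (\<lambda>s. \<bar>step_kernel \<tau> s - limit_kernel s\<bar>) (\<lambda>x. \<bar>h x\<bar>) t
      + convolution limit_kernel (\<lambda>x. \<bar>h x - g x\<bar>) t
      + convolution limit_kernel (\<lambda>x. \<bar>g x * indicator {..<\<tau>} x\<bar>) t"
proof -
  define N where "N = real (nat \<lfloor>t / \<tau>\<rfloor>) * \<tau>"
  have "t / \<tau> < real (nat \<lfloor>t / \<tau>\<rfloor>) + 1" by linarith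
  then have N: "t < N + \<tau>" using \<tau> by (simp add: N_def field_simps)
  note int_tr = truncated_convolution_le_majorant(1)[OF \<tau> _ int(4), folded N_def]
  have "\<bar>step_kernel \<tau> s * indicator {..N} s * h (t - s) - limit_kernel s * g (t - s)\<bar>
      \<le> \<bar>step_kernel \<tau> s - limit_kernel s\<bar> * \<bar>h (t - s)\<bar> + limit_kernel s * \<bar>h (t - s) - g (t - s)\<bar>
        + limit_kernel s * \<bar>g (t - s) * indicator {..<\<tau>} (t - s)\<bar>" for s
  proof (cases "s \<le> N")
    case True
    have "step_kernel \<tau> s * h (t - s) - limit_kernel s * g (t - s)
        = (step_kernel \<tau> s - limit_kernel s) * h (t - s) + limit_kernel s * (h (t - s) - g (t - s))"
      by (simp add: algebra_simps)
    then have "\<bar>step_kernel \<tau> s * h (t - s) - limit_kernel s * g (t - s)\<bar>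
        \<le> \<bar>step_kernel \<tau> s - limit_kernel s\<bar> * \<bar>h (t - s)\<bar> + limit_kernel s * \<bar>h (t - s) - g (t - s)\<bar>"
      using abs_triangle_ineq[of "(step_kernel \<tau> s - limit_kernel s) * h (t - s)" "limit_kernel s * (h (t - s) - g (t - s))"]
        limit_kernel_nonneg[of s] by (simp add: abs_mult)
    also have "\<dots> \<le> \<dots> + limit_kernel s * \<bar>g (t - s) * indicator {..<\<tau>} (t - s)\<bar>"
      using limit_kernel_nonneg[of s] by simp
    finally show ?thesis using True by simp
  next
    case False
    then have "t - s < \<tau>" using N by simp
    then show ?thesis
      using False limit_kernel_nonneg[of s] by (simp add: abs_mult)
  qed
  then have "\<bar>LINT s|lborel. step_kernel \<tau> s * indicator {..N} s * h (t - s) - limit_kernel s * g (t - s)\<bar>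
      \<le> (LINT s|lborel. \<bar>step_kernel \<tau> s - limit_kernel s\<bar> * \<bar>h (t - s)\<bar> + limit_kernel s * \<bar>h (t - s) - g (t - s)\<bar>
        + limit_kernel s * \<bar>g (t - s) * indicator {..<\<tau>} (t - s)\<bar>)"
    unfolding real_norm_def[symmetric] using int int_tr
    by (intro order.trans[OF integral_norm_bound] integral_mono integrable_norm) auto
  also have "\<dots> = convolution (\<lambda>s. \<bar>step_kernel \<tau> s - limit_kernel s\<bar>) (\<lambda>x. \<bar>h x\<bar>) t
      + convolution limit_kernel (\<lambda>x. \<bar>h x - g x\<bar>) t
      + convolution limit_kernel (\<lambda>x. \<bar>g x * indicator {..<\<tau>} x\<bar>) t"
    using int by (simp add: convolution_def)
  finally show ?thesis
    using int int_tr by (simp add: truncated_convolution_def convolution_def N_def)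
qed

text \<open>
  The condition on \<open>r\<close> is \<open>1 / q - (1 - \<alpha>) < 1 / r\<close>, that is, \<open>1 / p > \<alpha>\<close> for the exponent \<open>p\<close> that
  Young's inequality prescribes. For \<open>(1 - \<alpha>) * q \<ge> 1\<close> the left-hand side is not positive.
\<close>

lemma Young_exponent:
  fixes q r :: real
  assumes "1 \<le> q" "q \<le> r" and "(1 - \<alpha>) * q < 1 \<longrightarrow> r < q / (1 - (1 - \<alpha>) * q)"
  obtains p where "1 \<le> p" "p < 1 / \<alpha>" "1 / p + 1 / q = 1 + 1 / r"
proof -
  define x where "x = 1 + 1 / r - 1 / q"
  have "1 / r \<le> 1 / q" using assms by (simp add: frac_le)
  then have x_le: "x \<le> 1" by (simp add: x_def)
  have "1 / q - (1 - \<alpha>) < 1 / r"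
  proof (cases "(1 - \<alpha>) * q < 1")
    case True
    then have "r * (1 - (1 - \<alpha>) * q) < q"
      using assms by (simp add: pos_less_divide_eq)
    then show ?thesis
      using assms by (simp add: field_simps)
  next
    case False
    then have "1 / q \<le> 1 - \<alpha>" using assms by (simp add: field_simps)
    moreover have "0 < 1 / r" using assms by simp
    ultimately show ?thesis by linarith
  qed
  then have x_gt: "\<alpha> < x" by (simp add: x_def)
  then have "0 < x" using \<alpha>_pos by simp
  show ?thesis
  proof (rule that[of "1 / x"])
    show "1 \<le> 1 / x" using x_le \<open>0 < x\<close> by simp
    show "1 / x < 1 / \<alpha>" using x_gt \<alpha>_pos \<open>0 < x\<close> by (simp add: frac_less2)
    show "1 / (1 / x) + 1 / q = 1 + 1 / r" by (simp add: x_def)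
  qed
qed

context
  fixes p q r :: real
  assumes p: "1 \<le> p" "p < 1 / \<alpha>" and q: "1 \<le> q" and r: "1 \<le> r"
    and pqr: "1 / p + 1 / q = 1 + 1 / r"
begin

lemma truncated_convolution_integrable:
  assumes \<tau>: "0 < \<tau>" and [measurable]: "g \<in> borel_measurable borel"
    and g: "integrable lborel (\<lambda>x. \<bar>g x\<bar> powr q)"
  shows "integrable lborel (\<lambda>t. \<bar>truncated_convolution \<tau> g t\<bar> powr r)"
proof -
  note Y = Young_convolution[OF _ _ majorant_nonneg abs_ge_zero p(1) q r pqr majorant_integrable[OF p] g]
  show ?thesis
  proof (rule Bochner_Integration.integrable_bound)
    show "integrable lborel (\<lambda>t. convolution majorant (\<lambda>x. \<bar>g x\<bar>) t powr r)"
      by (rule Y(2)) auto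
    have "AE t in lborel. integrable lborel (\<lambda>s. majorant s * \<bar>g (t - s)\<bar>)"
      by (rule Y(1)) auto
    then show "AE t in lborel. norm (\<bar>truncated_convolution \<tau> g t\<bar> powr r)
        \<le> norm (convolution majorant (\<lambda>x. \<bar>g x\<bar>) t powr r)"
    proof eventually_elim
      case (elim t)
      from truncated_convolution_le_majorant(2)[OF \<tau> _ this] show ?case
        using r by (auto intro!: powr_mono2)
    qed
  qed measurable
qed

lemma limit_convolution_integrable:
  assumes [measurable]: "g \<in> borel_measurable borel"
    and g: "integrable lborel (\<lambda>x. \<bar>g x\<bar> powr q)"
  shows "AE t in lborel. integrable lborel (\<lambda>s. limit_kernel s * g (t - s))"
    and "integrable lborel (\<lambda>t. \<bar>convolution limit_kernel g t\<bar> powr r)"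
proof -
  note Y = Young_convolution[OF _ _ limit_kernel_nonneg abs_ge_zero p(1) q r pqr limit_kernel_integrable[OF p] g]
  have "AE t in lborel. integrable lborel (\<lambda>s. limit_kernel s * \<bar>g (t - s)\<bar>)"
    by (rule Y(1)) auto
  then have both: "AE t in lborel. integrable lborel (\<lambda>s. limit_kernel s * g (t - s))
      \<and> \<bar>convolution limit_kernel g t\<bar> \<le> convolution limit_kernel (\<lambda>x. \<bar>g x\<bar>) t"
  proof eventually_elim
    case (elim t)
    have bound: "\<bar>limit_kernel s * g (t - s)\<bar> = limit_kernel s * \<bar>g (t - s)\<bar>" for s
      using limit_kernel_nonneg[of s] by (simp add: abs_mult)
    have "integrable lborel (\<lambda>s. limit_kernel s * g (t - s))"
      using elim by (subst integrable_abs_iff[symmetric]) (auto simp: bound simp del: abs_mult)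
    moreover have "\<bar>convolution limit_kernel g t\<bar> \<le> convolution limit_kernel (\<lambda>x. \<bar>g x\<bar>) t"
      using integral_abs_bound[of lborel "\<lambda>s. limit_kernel s * g (t - s)"]
      by (simp add: convolution_def bound del: abs_mult)
    ultimately show ?case by simp
  qed
  then show "AE t in lborel. integrable lborel (\<lambda>s. limit_kernel s * g (t - s))"
    by auto
  show "integrable lborel (\<lambda>t. \<bar>convolution limit_kernel g t\<bar> powr r)"
  proof (rule Bochner_Integration.integrable_bound)
    show "integrable lborel (\<lambda>t. convolution limit_kernel (\<lambda>x. \<bar>g x\<bar>) t powr r)"
      by (rule Y(2)) auto
    show "AE t in lborel. norm (\<bar>convolution limit_kernel g t\<bar> powr r)
        \<le> norm (convolution limit_kernel (\<lambda>x. \<bar>g x\<bar>) t powr r)"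
      using both by eventually_elim (use r in \<open>auto intro!: powr_mono2\<close>)
  qed measurable
qed

text \<open>
  Young's inequality bounds the three parts of the error by the product of one norm that tends to \<open>0\<close>
  with one that stays bounded; these bounds are added up in \<open>R\<close>.
\<close>

lemma truncated_convolution_tendsto:
  fixes g :: "real \<Rightarrow> real" and h :: "real \<Rightarrow> real \<Rightarrow> real"
  assumes g [measurable]: "g \<in> borel_measurable borel" and g0: "\<And>x. x \<le> 0 \<Longrightarrow> g x = 0"
    and h [measurable]: "\<And>\<tau>. h \<tau> \<in> borel_measurable borel"
    and g_int: "integrable lborel (\<lambda>x. \<bar>g x\<bar> powr q)"
    and h_int: "\<And>\<tau>. 0 < \<tau> \<Longrightarrow> integrable lborel (\<lambda>x. \<bar>h \<tau> x\<bar> powr q)"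
    and lim: "((\<lambda>\<tau>. LINT x|lborel. \<bar>h \<tau> x - g x\<bar> powr q) \<longlongrightarrow> 0) (at_right 0)"
  shows "((\<lambda>\<tau>. LINT t|lborel. indicator {0<..<T} t *
            \<bar>truncated_convolution \<tau> (h \<tau>) t - convolution limit_kernel g t\<bar> powr r) \<longlongrightarrow> 0) (at_right 0)"
proof -
  define a where "a \<tau> = (LINT s|lborel. \<bar>step_kernel \<tau> s - limit_kernel s\<bar> powr p)" for \<tau>
  define K where "K = (LINT s|lborel. limit_kernel s powr p)"
  define e where "e \<tau> = (LINT x|lborel. \<bar>h \<tau> x - g x\<bar> powr q)" for \<tau>
  define b where "b \<tau> = (LINT x|lborel. \<bar>h \<tau> x\<bar> powr q)" for \<tau>
  define G where "G = (LINT x|lborel. \<bar>g x\<bar> powr q)"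
  define z where "z \<tau> = (LINT x|lborel. \<bar>g x * indicator {..<\<tau>} x\<bar> powr q)" for \<tau>
  have ge: "0 \<le> a \<tau>" "0 \<le> K" "0 \<le> e \<tau>" "0 \<le> b \<tau>" "0 \<le> G" "0 \<le> z \<tau>" for \<tau>
    unfolding a_def K_def e_def b_def G_def z_def by (auto intro!: integral_nonneg_AE)
  have e_int: "integrable lborel (\<lambda>x. \<bar>h \<tau> x - g x\<bar> powr q)" if "0 < \<tau>" for \<tau>
    using Lp_space_diff[of q "h \<tau>" lborel g] g_int h_int[OF that] q by (simp add: Lp_space_def)
  have z_le: "\<bar>g x * indicator {..<\<tau>} x\<bar> powr q \<le> \<bar>g x\<bar> powr q" for x \<tau>
    by (simp add: indicator_def)
  have z_int: "integrable lborel (\<lambda>x. \<bar>g x * indicator {..<\<tau>} x\<bar> powr q)" for \<tau>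
    by (rule Bochner_Integration.integrable_bound[OF g_int]) (use z_le in auto)
  have b_le: "b \<tau> \<le> 3 powr q * (e \<tau> + G)" if "0 < \<tau>" for \<tau>
  proof -
    have "b \<tau> \<le> (LINT x|lborel. 3 powr q * (\<bar>h \<tau> x - g x\<bar> powr q + \<bar>g x\<bar> powr q))"
      unfolding b_def
    proof (intro integral_mono h_int[OF that] integrable_mult_right Bochner_Integration.integrable_add e_int[OF that] g_int)
      fix x
      show "\<bar>h \<tau> x\<bar> powr q \<le> 3 powr q * (\<bar>h \<tau> x - g x\<bar> powr q + \<bar>g x\<bar> powr q)"
        using abs_add_powr_le[of q "h \<tau> x - g x" "g x"] q by simp
    qed
    also have "\<dots> = 3 powr q * (e \<tau> + G)"
      using e_int[OF that] g_int by (simp add: e_def G_def)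
    finally show ?thesis .
  qed
  have z_lim: "(z \<longlongrightarrow> 0) (at_right 0)"
  proof -
    have "(z \<longlongrightarrow> (LINT x|(lborel::real measure). (0::real))) (at_right 0)"
      unfolding z_def
    proof (rule dominated_convergence_at_right[OF _ _ g_int])
      show "AE x in lborel. ((\<lambda>\<tau>. \<bar>g x * indicator {..<\<tau>} x\<bar> powr q) \<longlongrightarrow> 0) (at_right 0)"
      proof (intro AE_I2)
        fix x
        have "\<forall>\<^sub>F \<tau> in at_right 0. \<bar>g x * indicator {..<\<tau>} x\<bar> powr q = 0"
        proof (cases "x \<le> 0")
          case False
          then have "\<forall>\<^sub>F \<tau> in at_right 0. \<tau> \<in> {0<..<x}"
            by (intro eventually_at_right_real) simp
          then show ?thesis by eventually_elim auto
        qed (simp add: g0)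
        then show "((\<lambda>\<tau>. \<bar>g x * indicator {..<\<tau>} x\<bar> powr q) \<longlongrightarrow> 0) (at_right 0)"
          by (rule tendsto_eventually)
      qed
    qed (use z_le in auto)
    then show ?thesis by simp
  qed
  define X where "X \<tau> = convolution (\<lambda>s. \<bar>step_kernel \<tau> s - limit_kernel s\<bar>) (\<lambda>x. \<bar>h \<tau> x\<bar>)" for \<tau>
  define Y where "Y \<tau> = convolution limit_kernel (\<lambda>x. \<bar>h \<tau> x - g x\<bar>)" for \<tau>
  define Z where "Z \<tau> = convolution limit_kernel (\<lambda>x. \<bar>g x * indicator {..<\<tau>} x\<bar>)" for \<tau>
  define E where "E \<tau> t = \<bar>truncated_convolution \<tau> (h \<tau>) t - convolution limit_kernel g t\<bar>" for \<tau> t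
  \<comment> \<open>The summands \<open>1\<close> make the limits of the bounded factors positive, so that their powers converge.\<close>
  define R where "R \<tau> = 3 powr r * (a \<tau> powr (r / p) * (3 powr q * (e \<tau> + G + 1)) powr (r / q)
      + e \<tau> powr (r / q) * (K + 1) powr (r / p) + z \<tau> powr (r / q) * (K + 1) powr (r / p))" for \<tau>
  have E_le_R: "(LINT t|lborel. indicator {0<..<T} t * E \<tau> t powr r) \<le> R \<tau>" if \<tau>: "0 < \<tau>" for \<tau>
  proof -
    have zm: "(\<lambda>x. \<bar>g x * indicator {..<\<tau>} x\<bar>) \<in> borel_measurable borel" by measurable
    note YX = Young_convolution[OF _ _ abs_ge_zero abs_ge_zero p(1) q r pqr kernel_diff_integrable[OF p \<tau>] h_int[OF \<tau>]]
    note YY = Young_convolution[OF _ _ limit_kernel_nonneg abs_ge_zero p(1) q r pqr limit_kernel_integrable[OF p] e_int[OF \<tau>]]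
    note YZ = Young_convolution[OF _ zm limit_kernel_nonneg abs_ge_zero p(1) q r pqr limit_kernel_integrable[OF p] z_int]
    note YM = Young_convolution[OF _ _ majorant_nonneg abs_ge_zero p(1) q r pqr majorant_integrable[OF p] h_int[OF \<tau>]]
    have X: "AE t in lborel. integrable lborel (\<lambda>s. \<bar>step_kernel \<tau> s - limit_kernel s\<bar> * \<bar>h \<tau> (t - s)\<bar>)"
        "integrable lborel (\<lambda>t. X \<tau> t powr r)"
        "(LINT t|lborel. X \<tau> t powr r) \<le> a \<tau> powr (r / p) * b \<tau> powr (r / q)"
      using YX by (simp_all add: X_def a_def b_def)
    have Y: "AE t in lborel. integrable lborel (\<lambda>s. limit_kernel s * \<bar>h \<tau> (t - s) - g (t - s)\<bar>)"
        "integrable lborel (\<lambda>t. Y \<tau> t powr r)"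
        "(LINT t|lborel. Y \<tau> t powr r) \<le> K powr (r / p) * e \<tau> powr (r / q)"
      using YY by (simp_all add: Y_def K_def e_def)
    have Z: "AE t in lborel. integrable lborel (\<lambda>s. limit_kernel s * \<bar>g (t - s) * indicator {..<\<tau>} (t - s)\<bar>)"
        "integrable lborel (\<lambda>t. Z \<tau> t powr r)"
        "(LINT t|lborel. Z \<tau> t powr r) \<le> K powr (r / p) * z \<tau> powr (r / q)"
      using YZ by (simp_all add: Z_def K_def z_def)
    have M: "AE t in lborel. integrable lborel (\<lambda>s. majorant s * \<bar>h \<tau> (t - s)\<bar>)"
      by (rule YM(1)) auto
    have E_le: "AE t in lborel. indicator {0<..<T} t * E \<tau> t powr r
        \<le> 3 powr r * (X \<tau> t powr r + Y \<tau> t powr r + Z \<tau> t powr r)"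
      using X(1) Y(1) Z(1) M limit_convolution_integrable(1)[OF g g_int]
    proof eventually_elim
      case (elim t)
      have nonneg: "0 \<le> X \<tau> t" "0 \<le> Y \<tau> t" "0 \<le> Z \<tau> t"
        unfolding X_def Y_def Z_def by (auto intro!: convolution_nonneg limit_kernel_nonneg)
      show ?case
      proof (cases "t \<in> {0<..<T}")
        case True
        then have "E \<tau> t \<le> X \<tau> t + Y \<tau> t + Z \<tau> t"
          unfolding E_def X_def Y_def Z_def
          using \<tau> by (intro truncated_convolution_error elim) auto
        then have "E \<tau> t powr r \<le> \<bar>X \<tau> t + Y \<tau> t + Z \<tau> t\<bar> powr r"
          using r by (intro powr_mono2) (auto simp: E_def)
        then show ?thesis
          using True abs_add3_powr_le[of r "X \<tau> t" "Y \<tau> t" "Z \<tau> t"] r nonneg by simp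
      qed simp
    qed
    have dom: "integrable lborel (\<lambda>t. 3 powr r * (X \<tau> t powr r + Y \<tau> t powr r + Z \<tau> t powr r))"
      using X(2) Y(2) Z(2) by simp
    have [measurable]: "E \<tau> \<in> borel_measurable borel"
      unfolding E_def[abs_def] by measurable
    have "integrable lborel (\<lambda>t. indicator {0<..<T} t * E \<tau> t powr r)"
      by (rule Bochner_Integration.integrable_bound[OF dom]) (use E_le in auto)
    then have "(LINT t|lborel. indicator {0<..<T} t * E \<tau> t powr r)
        \<le> (LINT t|lborel. 3 powr r * (X \<tau> t powr r + Y \<tau> t powr r + Z \<tau> t powr r))"
      using dom E_le by (rule integral_mono_AE)
    also have "\<dots> = 3 powr r * ((LINT t|lborel. X \<tau> t powr r) + (LINT t|lborel. Y \<tau> t powr r) + (LINT t|lborel. Z \<tau> t powr r))"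
      using X(2) Y(2) Z(2) by simp
    also have "\<dots> \<le> 3 powr r * (a \<tau> powr (r / p) * b \<tau> powr (r / q)
        + K powr (r / p) * e \<tau> powr (r / q) + K powr (r / p) * z \<tau> powr (r / q))"
      by (intro mult_left_mono add_mono X(3) Y(3) Z(3)) auto
    also have "\<dots> \<le> R \<tau>"
    proof -
      have "b \<tau> \<le> 3 powr q * (e \<tau> + G + 1)"
        by (intro order.trans[OF b_le[OF \<tau>]] mult_left_mono) auto
      then have "b \<tau> powr (r / q) \<le> (3 powr q * (e \<tau> + G + 1)) powr (r / q)"
        using ge r q by (intro powr_mono2) auto
      moreover have "K powr (r / p) * y \<le> y * (K + 1) powr (r / p)" if "0 \<le> y" for y
        using ge r p that by (subst mult.commute) (intro mult_left_mono powr_mono2, auto)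
      ultimately show ?thesis
        unfolding R_def by (intro mult_left_mono add_mono) auto
    qed
    finally show ?thesis .
  qed
  have R_lim: "(R \<longlongrightarrow> 0) (at_right 0)"
  proof -
    have e_lim: "(e \<longlongrightarrow> 0) (at_right 0)" using lim by (simp add: e_def[abs_def])
    have "((\<lambda>\<tau>. 3 powr q * (e \<tau> + G + 1)) \<longlongrightarrow> 3 powr q * (0 + G + 1)) (at_right 0)"
      by (intro tendsto_intros e_lim)
    then have 1: "((\<lambda>\<tau>. a \<tau> powr (r / p) * (3 powr q * (e \<tau> + G + 1)) powr (r / q)) \<longlongrightarrow> 0) (at_right 0)"
    proof (rule Young_null[rotated 2])
      show "(a \<longlongrightarrow> 0) (at_right 0)"
        using step_kernel_tendsto_Lp[OF p] by (simp add: a_def[abs_def])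
    qed (use ge(1,5) r p in auto)
    have 2: "((\<lambda>\<tau>. e \<tau> powr (r / q) * (K + 1) powr (r / p)) \<longlongrightarrow> 0) (at_right 0)"
      using e_lim ge(2,3) r q by (intro Young_null[OF _ _ tendsto_const]) auto
    have 3: "((\<lambda>\<tau>. z \<tau> powr (r / q) * (K + 1) powr (r / p)) \<longlongrightarrow> 0) (at_right 0)"
      using z_lim ge(2,6) r q by (intro Young_null[OF _ _ tendsto_const]) auto
    show ?thesis
      unfolding R_def[abs_def] by (intro tendsto_mult_right_zero tendsto_add_zero 1 2 3)
  qed
  have "((\<lambda>\<tau>. LINT t|lborel. indicator {0<..<T} t * E \<tau> t powr r) \<longlongrightarrow> 0) (at_right 0)"
  proof (rule Lim_null_comparison[OF _ R_lim])
    show "\<forall>\<^sub>F \<tau> in at_right 0. norm (LINT t|lborel. indicator {0<..<T} t * E \<tau> t powr r) \<le> R \<tau>"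
      using eventually_at_right_less[of 0]
    proof eventually_elim
      case (elim \<tau>)
      then show ?case
        using E_le_R[OF elim] by (simp add: integral_nonneg_AE)
    qed
  qed
  then show ?thesis by (simp add: E_def)
qed

end

text \<open>
  If \<open>r < q\<close>, the limit is first taken in \<open>L\<^sup>q\<close>, which the condition on the exponents always allows.
\<close>

lemma discrete_convolution_strong_limit:
  fixes q r :: real and f\<tau> :: "real \<Rightarrow> real \<Rightarrow> real" and f :: "real \<Rightarrow> real"
  assumes q: "1 \<le> q" and r: "1 \<le> r" "(1 - \<alpha>) * q < 1 \<longrightarrow> r < q / (1 - (1 - \<alpha>) * q)"
    and lim: "Lp_strong_limit q (lebesgue_on {0<..<T}) f\<tau> f"
  shows "Lp_strong_limit r (lebesgue_on {0<..<T})
              (\<lambda>\<tau> t. let n = nat \<lfloor>t / \<tau>\<rfloor> in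
                 1 / \<tau> powr \<alpha> *
                 (LINT s:{0..real n * \<tau>}|lebesgue.
                    (\<Sum>k=1..n. lam k * indicator (mesh_cell \<tau> k) s) * f\<tau> \<tau> (t - s)))
              (\<lambda>t. 1 / (Gamma \<alpha> * Gamma (1 - \<alpha>)) *
                 (LINT s:{0..t}|lebesgue. s powr (- \<alpha>) * f (t - s)))"
    (is "Lp_strong_limit r ?M ?u ?v")
proof -
  interpret finite_measure ?M
    by (rule finite_measure_lebesgue_on) (auto simp: lmeasurable_interval)
  define r' where "r' = max q r"
  have r': "1 \<le> r'" "q \<le> r'" "r \<le> r'" using q r by (auto simp: r'_def)
  have "(1 - \<alpha>) * q < 1 \<longrightarrow> r' < q / (1 - (1 - \<alpha>) * q)"
  proof
    assume less: "(1 - \<alpha>) * q < 1"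
    have "q * (1 - (1 - \<alpha>) * q) < q * 1"
      using q \<alpha>_less by (intro mult_strict_left_mono) auto
    then have "q < q / (1 - (1 - \<alpha>) * q)" using less by (simp add: pos_less_divide_eq)
    then show "r' < q / (1 - (1 - \<alpha>) * q)" using r less by (simp add: r'_def)
  qed
  then obtain p where p: "1 \<le> p" "p < 1 / \<alpha>" "1 / p + 1 / q = 1 + 1 / r'"
    using Young_exponent[OF q r'(2)] by blast
  have f: "f \<in> Lp_space q ?M" and f\<tau>: "\<And>\<tau>. 0 < \<tau> \<Longrightarrow> f\<tau> \<tau> \<in> Lp_space q ?M"
    and f_lim: "((\<lambda>\<tau>. LINT x|?M. \<bar>f\<tau> \<tau> x - f x\<bar> powr q) \<longlongrightarrow> 0) (at_right 0)"
    using lim q by (auto simp: Lp_strong_limit_iff)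
  obtain g where g: "g \<in> borel_measurable borel" "\<And>x. x \<notin> {0<..<T} \<Longrightarrow> g x = 0"
      "AE x in lborel. x \<in> {0<..<T} \<longrightarrow> f x = g x"
    using f Borel_representative[of f T] by (auto simp: Lp_space_def)
  have "\<exists>h. h \<in> borel_measurable borel \<and> (\<forall>x. x \<notin> {0<..<T} \<longrightarrow> h x = 0) \<and>
      (0 < \<tau> \<longrightarrow> (AE x in lborel. x \<in> {0<..<T} \<longrightarrow> f\<tau> \<tau> x = h x))" for \<tau>
  proof (cases "0 < \<tau>")
    case True
    then show ?thesis
      using f\<tau>[OF True] Borel_representative[of "f\<tau> \<tau>" T] by (auto simp: Lp_space_def)
  qed (auto intro: exI[of _ "\<lambda>_. 0"])
  then obtain h where h: "\<And>\<tau>. h \<tau> \<in> borel_measurable borel" "\<And>\<tau> x. x \<notin> {0<..<T} \<Longrightarrow> h \<tau> x = 0"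
      "\<And>\<tau>. 0 < \<tau> \<Longrightarrow> AE x in lborel. x \<in> {0<..<T} \<longrightarrow> f\<tau> \<tau> x = h \<tau> x"
    by metis
  note [measurable] = g(1) h(1)
  have g_int: "integrable lborel (\<lambda>x. \<bar>g x\<bar> powr q)"
    using f Lp_Borel_representative(1)[OF g _ q] by (simp add: Lp_space_def)
  have h_int: "integrable lborel (\<lambda>x. \<bar>h \<tau> x\<bar> powr q)" if "0 < \<tau>" for \<tau>
    using f\<tau>[OF that] Lp_Borel_representative(1)[OF h(1,2) h(3)[OF that] _ q] by (simp add: Lp_space_def)
  have diff: "(LINT x|?M. \<bar>f\<tau> \<tau> x - f x\<bar> powr q) = (LINT x|lborel. \<bar>h \<tau> x - g x\<bar> powr q)" if "0 < \<tau>" for \<tau>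
  proof (rule Lp_Borel_representative(2)[OF _ _ _ _ q])
    show "AE x in lborel. x \<in> {0<..<T} \<longrightarrow> f\<tau> \<tau> x - f x = h \<tau> x - g x"
      using g(3) h(3)[OF that] by eventually_elim auto
    show "(\<lambda>x. f\<tau> \<tau> x - f x) \<in> borel_measurable ?M"
      using f f\<tau>[OF that] by (auto simp: Lp_space_def)
  qed (use g(2) h(2) in auto)
  have h_lim: "((\<lambda>\<tau>. LINT x|lborel. \<bar>h \<tau> x - g x\<bar> powr q) \<longlongrightarrow> 0) (at_right 0)"
    using f_lim by (rule Lim_transform_eventually)
      (rule eventually_mono[OF eventually_at_right_less[of 0]], rule diff)
  have u: "?u \<tau> t = truncated_convolution \<tau> (h \<tau>) t" if "0 < \<tau>" "t \<in> {0<..<T}" for \<tau> t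
    using that discrete_convolution_eq[OF that(1) _ h(1) h(3)[OF that(1)] refl] by (simp add: Let_def)
  have v: "?v t = convolution limit_kernel g t" if "t \<in> {0<..<T}" for t
    using that limit_convolution_eq[OF _ g] by simp
  have u_mem: "?u \<tau> \<in> Lp_space r' ?M" if "0 < \<tau>" for \<tau>
    using that by (intro Lp_space_lebesgue_onI[where k = "truncated_convolution \<tau> (h \<tau>)"] u
        borel_measurable_truncated_convolution h(1)
        truncated_convolution_integrable[OF p(1,2) q r'(1) p(3) _ h(1) h_int])
  have v_mem: "?v \<in> Lp_space r' ?M"
    by (intro Lp_space_lebesgue_onI[where k = "convolution limit_kernel g"] v borel_measurable_convolution borel_measurable_kernels g(1)
        limit_convolution_integrable(2)[OF p(1,2) q r'(1) p(3) g(1) g_int])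
  have "(LINT t|lborel. indicator {0<..<T} t * \<bar>truncated_convolution \<tau> (h \<tau>) t - convolution limit_kernel g t\<bar> powr r')
      = (LINT t|?M. \<bar>?u \<tau> t - ?v t\<bar> powr r')" if "0 < \<tau>" for \<tau>
  proof -
    have "(LINT t|?M. \<bar>?u \<tau> t - ?v t\<bar> powr r')
        = (LINT t|?M. \<bar>truncated_convolution \<tau> (h \<tau>) t - convolution limit_kernel g t\<bar> powr r')"
    proof (intro Bochner_Integration.integral_cong refl)
      fix t assume "t \<in> space ?M"
      then have "t \<in> {0<..<T}" by simp
      then show "\<bar>?u \<tau> t - ?v t\<bar> powr r'
          = \<bar>truncated_convolution \<tau> (h \<tau>) t - convolution limit_kernel g t\<bar> powr r'"
        by (simp only: u[OF that] v)
    qed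
    then show ?thesis
      by (subst (asm) integrable_lebesgue_on_iff) auto
  qed
  note error = eventually_mono[OF eventually_at_right_less[of 0] this]
  have "((\<lambda>\<tau>. LINT t|lborel. indicator {0<..<T} t *
      \<bar>truncated_convolution \<tau> (h \<tau>) t - convolution limit_kernel g t\<bar> powr r') \<longlongrightarrow> 0) (at_right 0)"
    by (rule truncated_convolution_tendsto[OF p(1,2) q r'(1) p(3) g(1) g(2) h(1) g_int h_int h_lim]) auto
  then have "((\<lambda>\<tau>. LINT t|?M. \<bar>?u \<tau> t - ?v t\<bar> powr r') \<longlongrightarrow> 0) (at_right 0)"
    by (rule Lim_transform_eventually) (rule error)
  then have "Lp_strong_limit r' ?M ?u ?v"
    using u_mem v_mem r' by (subst Lp_strong_limit_iff) auto
  then show ?thesis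
    by (rule Lp_strong_limit_exponent_mono[OF r(1) r'(3)])
qed

end

theorem proposition1:
  fixes \<alpha> T :: real and lam :: "nat \<Rightarrow> real"
  assumes "0 < \<alpha>" and "\<alpha> < 1" and "T > 0"
    and "lam 1 = 1"
    and "\<And>k. k \<ge> 1 \<Longrightarrow>
           lam (k + 1) = (\<Sum>j=1..k. (real (k - j + 1) powr (\<alpha> - 1)
                                     - real (k - j + 2) powr (\<alpha> - 1)) * lam j)"
  shows "(\<forall>k\<ge>1. lam (k + 1) < lam k \<and> lam k \<le> 1 / real k powr \<alpha>
                \<and> (\<Sum>j=1..k. lam j) \<le> real k powr (1 - \<alpha>))
    \<and> (\<forall>p. 1 \<le> p \<and> p < 1 / \<alpha> \<longrightarrow>
         Lp_weak_limit p (lebesgue_on {0<..<T})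
           (\<lambda>\<tau> t. \<tau> powr (- \<alpha>) * (\<Sum>\<^sub>\<infinity>k\<in>{1..}. lam k * indicator (mesh_cell \<tau> k) t))
           (\<lambda>t. t powr (- \<alpha>) / (Gamma \<alpha> * Gamma (1 - \<alpha>))))
    \<and> (\<forall>q (f\<tau> :: real \<Rightarrow> real \<Rightarrow> real) (f :: real \<Rightarrow> real).
         1 \<le> q \<and> Lp_strong_limit q (lebesgue_on {0<..<T}) f\<tau> f \<longrightarrow>
         (\<forall>r. 1 \<le> r \<and> ((1 - \<alpha>) * q < 1 \<longrightarrow> r < q / (1 - (1 - \<alpha>) * q)) \<longrightarrow>
            Lp_strong_limit r (lebesgue_on {0<..<T})
              (\<lambda>\<tau> t. let n = nat \<lfloor>t / \<tau>\<rfloor> in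
                 1 / \<tau> powr \<alpha> *
                 (LINT s:{0..real n * \<tau>}|lebesgue.
                    (\<Sum>k=1..n. lam k * indicator (mesh_cell \<tau> k) s) * f\<tau> \<tau> (t - s)))
              (\<lambda>t. 1 / (Gamma \<alpha> * Gamma (1 - \<alpha>)) *
                 (LINT s:{0..t}|lebesgue. s powr (- \<alpha>) * f (t - s)))))"
proof -
  interpret fractional_kernels \<alpha> lam T
    using assms by unfold_locales auto
  have bounds: "lam (k + 1) < lam k \<and> lam k \<le> 1 / real k powr \<alpha>
                \<and> (\<Sum>j=1..k. lam j) \<le> real k powr (1 - \<alpha>)" if "1 \<le> k" for k
    using lam_strict_decreasing[OF that] lam_le[OF that] sum_lam_le[OF that]
    by (simp add: powr_minus_divide)
  show ?thesis
  proof (intro conjI allI impI)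
    fix k :: nat assume "1 \<le> k"
    then show "lam (k + 1) < lam k" "lam k \<le> 1 / real k powr \<alpha>"
        "(\<Sum>j=1..k. lam j) \<le> real k powr (1 - \<alpha>)"
      using bounds by blast+
  next
    fix p :: real assume "1 \<le> p \<and> p < 1 / \<alpha>"
    then show "Lp_weak_limit p (lebesgue_on {0<..<T})
           (\<lambda>\<tau> t. \<tau> powr (- \<alpha>) * (\<Sum>\<^sub>\<infinity>k\<in>{1..}. lam k * indicator (mesh_cell \<tau> k) t))
           (\<lambda>t. t powr (- \<alpha>) / (Gamma \<alpha> * Gamma (1 - \<alpha>)))"
      by (elim conjE) (rule Lp_weak_limit_if_strong_limit[OF _ step_function_strong_limit])
  next
    fix q r :: real and f\<tau> :: "real \<Rightarrow> real \<Rightarrow> real" and f :: "real \<Rightarrow> real"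
    assume "1 \<le> q \<and> Lp_strong_limit q (lebesgue_on {0<..<T}) f\<tau> f"
      and "1 \<le> r \<and> ((1 - \<alpha>) * q < 1 \<longrightarrow> r < q / (1 - (1 - \<alpha>) * q))"
    then show "Lp_strong_limit r (lebesgue_on {0<..<T})
              (\<lambda>\<tau> t. let n = nat \<lfloor>t / \<tau>\<rfloor> in
                 1 / \<tau> powr \<alpha> *
                 (LINT s:{0..real n * \<tau>}|lebesgue.
                    (\<Sum>k=1..n. lam k * indicator (mesh_cell \<tau> k) s) * f\<tau> \<tau> (t - s)))
              (\<lambda>t. 1 / (Gamma \<alpha> * Gamma (1 - \<alpha>)) *
                 (LINT s:{0..t}|lebesgue. s powr (- \<alpha>) * f (t - s)))"
      by (elim conjE) (rule discrete_convolution_strong_limit)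
  qed
qed

end
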